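(* Let $G$ be a simply connected real Lie group with Lie algebra $\mathfrak g$, let $\Gamma<G$ be a cocompact lattice, and let $m$ be the Haar measure on $\Gamma\backslash G$. For an affine automorphism $A\colon\Gamma\backslash G\to\Gamma\backslash G$, let $\mathcal J_{\Gamma\backslash G}(A)$ denote the (possibly empty) set of all $A$-invariant complex structures on $\Gamma\backslash G$. (i) If $A$ is ergodic with respect to $m$, then $\mathcal J_{\Gamma\backslash G}(A)$ is contained in a finite-dimensional linear subspace $\mathcal E_A\subset C^\infty(\Gamma\backslash G,\operatorname{End}(\mathfrak g))$ depending only on $A$. (ii) If $A$ is weakly mixing with respect to $m$, then every element of $\mathcal J_{\Gamma\backslash G}(A)$ is a left-invariant complex structure.
   Context: Affine automorphism: a diffeomorphism $A$ of $\Gamma\backslash G$ induced by a map of the form $g\mapsto g_0\Phi(g)$ of $G$, where $g_0\in G$ and $\Phi$ is a Lie group automorphism of $G$ (the linear part) with $g_0\Phi(\Gamma)g_0^{-1}=\Gamma$. The Haar measure $m$ is the $G$-invariant probability measure on $\Gamma\backslash G$. The tangent bundle $T(\Gamma\backslash G)$ is identified with $(\Gamma\backslash G)\times\mathfrak g$ by means of left-invariant vector fields on $G$ (which descend to $\Gamma\backslash G$). Via this trivialization, bundle endomorphisms of $T(\Gamma\backslash G)$ are identified with maps $\Gamma\backslash G\to\operatorname{End}(\mathfrak g)=\operatorname{End}_{\mathbb R}(\mathfrak g)$. A complex structure on a smooth manifold $M$ is a smooth bundle endomorphism $J$ of $TM$ with $J^2=-\operatorname{Id}$ that is integrable, i.e.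 induced by a complex manifold structure on $M$. It is $A$-invariant if $DA_x\circ J_x=J_{A(x)}\circ DA_x$ for all $x$, i.e. $A$ is holomorphic with respect to $J$. A complex structure on $\Gamma\backslash G$ is left-invariant if it is represented by a constant element of $\operatorname{End}(\mathfrak g)$ in the trivialization $T(\Gamma\backslash G)\cong(\Gamma\backslash G)\times\mathfrak g$ given by left-invariant vector fields on $G$. *)

theory Defs
  imports
    "HOL-Probability.Probability"
    "HOL-Algebra.Coset"
    "HOL-Library.Function_Algebras"
begin

section \<open>Functions with values in a real vector space\<close>

instantiation "fun" :: (type, real_vector) real_vector
begin

definition scaleR_fun :: "real \<Rightarrow> ('a \<Rightarrow> 'b) \<Rightarrow> 'a \<Rightarrow> 'b" where
  "scaleR_fun c f = (\<lambda>x. c *\<^sub>R f x)"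

instance
  by standard (auto simp: scaleR_fun_def plus_fun_def fun_eq_iff algebra_simps)

end

section \<open>Smooth functions on open subsets of a normed space\<close>

primrec Ck_on :: "nat \<Rightarrow> ('a::real_normed_vector \<Rightarrow> 'b::real_normed_vector) \<Rightarrow> 'a set \<Rightarrow> bool" where
  "Ck_on 0 f S \<longleftrightarrow> continuous_on S f"
| "Ck_on (Suc k) f S \<longleftrightarrow>
     (\<forall>x\<in>S. f differentiable (at x)) \<and> (\<forall>v. Ck_on k (\<lambda>x. frechet_derivative f (at x) v) S)"

text \<open>Only used for open \<open>S\<close> in a finite-dimensional space, where it is the usual notion.\<close>

definition smooth_on :: "'a set \<Rightarrow> ('a::real_normed_vector \<Rightarrow> 'b::real_normed_vector) \<Rightarrow> bool" where
  "smooth_on S f \<longleftrightarrow> (\<forall>k. Ck_on k f S)"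

section \<open>Smooth manifolds\<close>

text \<open>
  A chart is a pair \<open>(U, \<phi>)\<close>; the values of \<open>\<phi>\<close> outside \<open>U\<close> are irrelevant. The model space
  \<open>'e\<close> is a finite-dimensional normed space; the class \<^class>\<open>euclidean_space\<close> is avoided because
  it excludes dimension 0.
\<close>

type_synonym ('m, 'e) chart = "'m set \<times> ('m \<Rightarrow> 'e)"

record ('m, 'e) mfd =
  mtop :: "'m topology"
  atlas :: "('m, 'e) chart set"

definition is_chart :: "'m topology \<Rightarrow> ('m, 'e::real_normed_vector) chart \<Rightarrow> bool" where
  "is_chart X c \<longleftrightarrow> openin X (fst c) \<and> open (snd c ` fst c) \<and>
     homeomorphic_map (subtopology X (fst c)) (top_of_set (snd c ` fst c)) (snd c)"

definition transition :: "('m, 'e) chart \<Rightarrow> ('m, 'f) chart \<Rightarrow> 'e \<Rightarrow> 'f" where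
  "transition c d = snd d \<circ> inv_into (fst c) (snd c)"

definition compatible ::
  "('m, 'e::real_normed_vector) chart \<Rightarrow> ('m, 'e) chart \<Rightarrow> bool" where
  "compatible c d \<longleftrightarrow>
     smooth_on (snd c ` (fst c \<inter> fst d)) (transition c d) \<and>
     smooth_on (snd d ` (fst c \<inter> fst d)) (transition d c)"

definition manifold :: "('m, 'e::real_normed_vector) mfd \<Rightarrow> bool" where
  "manifold M \<longleftrightarrow>
     (\<exists>B::'e set. finite B \<and> span B = UNIV) \<and>
     Hausdorff_space (mtop M) \<and> second_countable (mtop M) \<and>
     (\<forall>c\<in>atlas M. is_chart (mtop M) c) \<and>
     (\<Union>c\<in>atlas M. fst c) = topspace (mtop M) \<and>
     (\<forall>c\<in>atlas M. \<forall>d\<in>atlas M. compatible c d)"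

text \<open>The members of the maximal atlas:\<close>

definition smooth_chart :: "('m, 'e::real_normed_vector) mfd \<Rightarrow> ('m, 'e) chart \<Rightarrow> bool" where
  "smooth_chart M c \<longleftrightarrow> is_chart (mtop M) c \<and> (\<forall>d\<in>atlas M. compatible c d)"

definition smooth_map ::
  "('m, 'e::real_normed_vector) mfd \<Rightarrow> ('n, 'f::real_normed_vector) mfd \<Rightarrow> ('m \<Rightarrow> 'n) \<Rightarrow> bool" where
  "smooth_map M N f \<longleftrightarrow> continuous_map (mtop M) (mtop N) f \<and>
     (\<forall>c\<in>atlas M. \<forall>d\<in>atlas N.
        smooth_on (snd c ` {x \<in> fst c. f x \<in> fst d}) (snd d \<circ> f \<circ> inv_into (fst c) (snd c)))"

definition diffeo ::
  "('m, 'e::real_normed_vector) mfd \<Rightarrow> ('n, 'f::real_normed_vector) mfd \<Rightarrow> ('m \<Rightarrow> 'n) \<Rightarrow> bool" where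
  "diffeo M N f \<longleftrightarrow> bij_betw f (topspace (mtop M)) (topspace (mtop N)) \<and>
     smooth_map M N f \<and> smooth_map N M (inv_into (topspace (mtop M)) f)"

definition prod_mfd :: "('m, 'e) mfd \<Rightarrow> ('n, 'f) mfd \<Rightarrow> ('m \<times> 'n, 'e \<times> 'f) mfd" where
  "prod_mfd M N =
     \<lparr>mtop = prod_topology (mtop M) (mtop N),
      atlas = {(fst c \<times> fst d, map_prod (snd c) (snd d)) | c d. c \<in> atlas M \<and> d \<in> atlas N}\<rparr>"

text \<open>
  Smooth vector-valued functions on a manifold, extended by 0 off its carrier so that they form
  a linear subspace of the function space.
\<close>

definition C_infinity ::
  "('m, 'e::real_normed_vector) mfd \<Rightarrow> ('m \<Rightarrow> 'v::real_normed_vector) set" where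
  "C_infinity M = {F. (\<forall>x. x \<notin> topspace (mtop M) \<longrightarrow> F x = 0) \<and>
     (\<forall>c\<in>atlas M. smooth_on (snd c ` fst c) (F \<circ> inv_into (fst c) (snd c)))}"

text \<open>As \<^const>\<open>simply_connected\<close>, for an abstract topology; this includes path-connectedness.\<close>

definition simply_connected_space :: "'m topology \<Rightarrow> bool" where
  "simply_connected_space X \<longleftrightarrow>
     (\<forall>p q. pathin X p \<and> p 1 = p 0 \<and> pathin X q \<and> q 1 = q 0 \<longrightarrow>
        homotopic_with (\<lambda>r. r 1 = r 0) (top_of_set {0..1}) X p q)"

lemma simply_connected_space_top_of_set:
  "simply_connected_space (top_of_set S) \<longleftrightarrow> simply_connected S"
  unfolding simply_connected_space_def simply_connected_def homotopic_loops_def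
  by (auto simp: pathin_def path_def path_image_def pathstart_def pathfinish_def
      image_subset_iff_funcset)

section \<open>The tangent bundle\<close>

text \<open>
  The tangent space of \<open>M\<close> at \<open>x\<close> is the model space \<open>'e\<close>, a vector being given by its
  coordinates in a chart chosen once and for all at \<open>x\<close>. Derivatives of maps are read in these
  charts.
\<close>

definition chart_at :: "('m, 'e) mfd \<Rightarrow> 'm \<Rightarrow> ('m, 'e) chart" where
  "chart_at M x = (SOME c. c \<in> atlas M \<and> x \<in> fst c)"

definition coord_deriv ::
  "('m, 'e) chart \<Rightarrow> ('n, 'f) chart \<Rightarrow> ('m \<Rightarrow> 'n) \<Rightarrow> 'm \<Rightarrow>
   ('e::real_normed_vector \<Rightarrow>\<^sub>L 'f::real_normed_vector)" where
  "coord_deriv c d f x =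
     Blinfun (frechet_derivative (snd d \<circ> f \<circ> inv_into (fst c) (snd c)) (at (snd c x)))"

definition tangent_map ::
  "('m, 'e) mfd \<Rightarrow> ('n, 'f) mfd \<Rightarrow> ('m \<Rightarrow> 'n) \<Rightarrow> 'm \<Rightarrow>
   ('e::real_normed_vector \<Rightarrow>\<^sub>L 'f::real_normed_vector)" where
  "tangent_map M N f x = coord_deriv (chart_at M x) (chart_at N (f x)) f x"

text \<open>The coordinates of a tangent vector at \<open>x\<close> in an arbitrary chart, and conversely:\<close>

definition to_chart ::
  "('m, 'e) mfd \<Rightarrow> ('m, 'e) chart \<Rightarrow> 'm \<Rightarrow> ('e::real_normed_vector \<Rightarrow>\<^sub>L 'e)" where
  "to_chart M c x = coord_deriv (chart_at M x) c id x"

definition from_chart ::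
  "('m, 'e) mfd \<Rightarrow> ('m, 'e) chart \<Rightarrow> 'm \<Rightarrow> ('e::real_normed_vector \<Rightarrow>\<^sub>L 'e)" where
  "from_chart M c x = coord_deriv c (chart_at M x) id x"

definition smooth_endo ::
  "('m, 'e) mfd \<Rightarrow> ('m \<Rightarrow> ('e::real_normed_vector \<Rightarrow>\<^sub>L 'e)) \<Rightarrow> bool" where
  "smooth_endo M J \<longleftrightarrow>
     (\<forall>c\<in>atlas M. smooth_on (snd c ` fst c)
        ((\<lambda>x. to_chart M c x o\<^sub>L J x o\<^sub>L from_chart M c x) \<circ> inv_into (fst c) (snd c)))"

section \<open>Complex structures\<close>

text \<open>
  A complex vector space is presented as a real one together with the multiplication \<open>I\<close> by the
  imaginary unit. Thus \<open>('e, I)\<close> plays the role of \<open>\<complex>\<^sup>k\<close>, and a smooth map between open sets is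
  holomorphic iff its derivatives are complex linear, i.e. commute with \<open>I\<close>.
\<close>

definition complex_unit :: "('e::real_normed_vector \<Rightarrow>\<^sub>L 'e) \<Rightarrow> bool" where
  "complex_unit I \<longleftrightarrow> I o\<^sub>L I = - id_blinfun"

definition holomorphic_atlas ::
  "('m, 'e::real_normed_vector) mfd \<Rightarrow> ('e \<Rightarrow>\<^sub>L 'e) \<Rightarrow> ('m, 'e) chart set \<Rightarrow> bool" where
  "holomorphic_atlas M I \<C> \<longleftrightarrow>
     (\<forall>c\<in>\<C>. smooth_chart M c) \<and> (\<Union>c\<in>\<C>. fst c) = topspace (mtop M) \<and>
     (\<forall>c\<in>\<C>. \<forall>d\<in>\<C>. \<forall>x\<in>fst c \<inter> fst d. coord_deriv c d id x o\<^sub>L I = I o\<^sub>L coord_deriv c d id x)"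

definition integrable_structure ::
  "('m, 'e::real_normed_vector) mfd \<Rightarrow> ('m \<Rightarrow> ('e \<Rightarrow>\<^sub>L 'e)) \<Rightarrow> bool" where
  "integrable_structure M J \<longleftrightarrow>
     (\<exists>I \<C>. complex_unit I \<and> holomorphic_atlas M I \<C> \<and>
        (\<forall>c\<in>\<C>. \<forall>x\<in>fst c. to_chart M c x o\<^sub>L J x = I o\<^sub>L to_chart M c x))"

definition complex_structure ::
  "('m, 'e::real_normed_vector) mfd \<Rightarrow> ('m \<Rightarrow> ('e \<Rightarrow>\<^sub>L 'e)) \<Rightarrow> bool" where
  "complex_structure M J \<longleftrightarrow> smooth_endo M J \<and>
     (\<forall>x\<in>topspace (mtop M). J x o\<^sub>L J x = - id_blinfun) \<and> integrable_structure M J"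

definition invariant_complex_structures ::
  "('m, 'e::real_normed_vector) mfd \<Rightarrow> ('m \<Rightarrow> 'm) \<Rightarrow> ('m \<Rightarrow> ('e \<Rightarrow>\<^sub>L 'e)) set" where
  "invariant_complex_structures M A = {J. complex_structure M J \<and>
     (\<forall>x\<in>topspace (mtop M). tangent_map M M A x o\<^sub>L J x = J (A x) o\<^sub>L tangent_map M M A x)}"

section \<open>Lie groups and their quotients by discrete subgroups\<close>

definition lie_group :: "('g, 'r) monoid_scheme \<Rightarrow> ('g, 'e::real_normed_vector) mfd \<Rightarrow> bool" where
  "lie_group G M \<longleftrightarrow> group G \<and> manifold M \<and> topspace (mtop M) = carrier G \<and>
     smooth_map (prod_mfd M M) M (\<lambda>(g, h). g \<otimes>\<^bsub>G\<^esub> h) \<and> smooth_map M M (\<lambda>g. inv\<^bsub>G\<^esub> g)"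

definition lie_group_automorphism ::
  "('g, 'r) monoid_scheme \<Rightarrow> ('g, 'e::real_normed_vector) mfd \<Rightarrow> ('g \<Rightarrow> 'g) \<Rightarrow> bool" where
  "lie_group_automorphism G M \<Phi> \<longleftrightarrow> \<Phi> \<in> iso G G \<and> diffeo M M \<Phi>"

definition quotient_top :: "('g, 'r) monoid_scheme \<Rightarrow> 'g topology \<Rightarrow> 'g set \<Rightarrow> 'g set topology" where
  "quotient_top G X \<Gamma> =
     topology (\<lambda>V. V \<subseteq> rcosets\<^bsub>G\<^esub> \<Gamma> \<and> openin X {g \<in> topspace X. \<Gamma> #>\<^bsub>G\<^esub> g \<in> V})"

lemma openin_quotient_top:
  "openin (quotient_top G X \<Gamma>) V \<longleftrightarrow>
     V \<subseteq> rcosets\<^bsub>G\<^esub> \<Gamma> \<and> openin X {g \<in> topspace X. \<Gamma> #>\<^bsub>G\<^esub> g \<in> V}"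
proof -
  have "istopology (\<lambda>V. V \<subseteq> rcosets\<^bsub>G\<^esub> \<Gamma> \<and> openin X {g \<in> topspace X. \<Gamma> #>\<^bsub>G\<^esub> g \<in> V})"
    unfolding istopology_def
  proof (intro conjI allI impI)
    fix S T
    assume S: "S \<subseteq> rcosets\<^bsub>G\<^esub> \<Gamma> \<and> openin X {g \<in> topspace X. \<Gamma> #>\<^bsub>G\<^esub> g \<in> S}"
      and T: "T \<subseteq> rcosets\<^bsub>G\<^esub> \<Gamma> \<and> openin X {g \<in> topspace X. \<Gamma> #>\<^bsub>G\<^esub> g \<in> T}"
    show "S \<inter> T \<subseteq> rcosets\<^bsub>G\<^esub> \<Gamma>" using S by blast
    show "openin X {g \<in> topspace X. \<Gamma> #>\<^bsub>G\<^esub> g \<in> S \<inter> T}" (is "openin X ?P")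
    proof -
      have "openin X ({g \<in> topspace X. \<Gamma> #>\<^bsub>G\<^esub> g \<in> S} \<inter> {g \<in> topspace X. \<Gamma> #>\<^bsub>G\<^esub> g \<in> T})"
        using S T by (intro openin_Int) blast+
      moreover have "?P = {g \<in> topspace X. \<Gamma> #>\<^bsub>G\<^esub> g \<in> S} \<inter> {g \<in> topspace X. \<Gamma> #>\<^bsub>G\<^esub> g \<in> T}"
        by blast
      ultimately show ?thesis by (rule ssubst[rotated])
    qed
  next
    fix \<K>
    assume K: "\<forall>K\<in>\<K>. K \<subseteq> rcosets\<^bsub>G\<^esub> \<Gamma> \<and> openin X {g \<in> topspace X. \<Gamma> #>\<^bsub>G\<^esub> g \<in> K}"
    then show "\<Union>\<K> \<subseteq> rcosets\<^bsub>G\<^esub> \<Gamma>" by blast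
    have eq: "{g \<in> topspace X. \<Gamma> #>\<^bsub>G\<^esub> g \<in> \<Union>\<K>} =
        \<Union>((\<lambda>K. {g \<in> topspace X. \<Gamma> #>\<^bsub>G\<^esub> g \<in> K}) ` \<K>)" by blast
    show "openin X {g \<in> topspace X. \<Gamma> #>\<^bsub>G\<^esub> g \<in> \<Union>\<K>}"
      unfolding eq using K by (intro openin_Union) blast
  qed
  then show ?thesis by (simp add: quotient_top_def topology_inverse')
qed

text \<open>
  \<open>\<Gamma>\G\<close> is the space of right cosets \<open>\<Gamma>g\<close>. Its charts are the smooth charts of \<open>G\<close> on
  whose domain the projection is injective, pushed down to \<open>\<Gamma>\G\<close>; so the projection is a local
  diffeomorphism when \<open>\<Gamma>\<close> is discrete.
\<close>

definition quotient_mfd ::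
  "('g, 'r) monoid_scheme \<Rightarrow> ('g, 'e::real_normed_vector) mfd \<Rightarrow> 'g set \<Rightarrow> ('g set, 'e) mfd" where
  "quotient_mfd G M \<Gamma> =
     \<lparr>mtop = quotient_top G (mtop M) \<Gamma>,
      atlas = {(((#>\<^bsub>G\<^esub>) \<Gamma>) ` U, \<phi> \<circ> inv_into U ((#>\<^bsub>G\<^esub>) \<Gamma>)) | U \<phi>.
                 smooth_chart M (U, \<phi>) \<and> inj_on ((#>\<^bsub>G\<^esub>) \<Gamma>) U}\<rparr>"

definition haar_measure ::
  "('g, 'r) monoid_scheme \<Rightarrow> ('g, 'e::real_normed_vector) mfd \<Rightarrow> 'g set \<Rightarrow> 'g set measure \<Rightarrow> bool" where
  "haar_measure G M \<Gamma> m \<longleftrightarrow> prob_space m \<and> space m = rcosets\<^bsub>G\<^esub> \<Gamma> \<and>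
     sets m = sigma_sets (rcosets\<^bsub>G\<^esub> \<Gamma>) {V. openin (mtop (quotient_mfd G M \<Gamma>)) V} \<and>
     (\<forall>h\<in>carrier G. distr m m (\<lambda>x. x #>\<^bsub>G\<^esub> h) = m)"

definition lattice_subgroup ::
  "('g, 'r) monoid_scheme \<Rightarrow> ('g, 'e::real_normed_vector) mfd \<Rightarrow> 'g set \<Rightarrow> bool" where
  "lattice_subgroup G M \<Gamma> \<longleftrightarrow> subgroup \<Gamma> G \<and>
     subtopology (mtop M) \<Gamma> = discrete_topology \<Gamma> \<and> (\<exists>m. haar_measure G M \<Gamma> m)"

definition cocompact_lattice ::
  "('g, 'r) monoid_scheme \<Rightarrow> ('g, 'e::real_normed_vector) mfd \<Rightarrow> 'g set \<Rightarrow> bool" where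
  "cocompact_lattice G M \<Gamma> \<longleftrightarrow>
     lattice_subgroup G M \<Gamma> \<and> compact_space (mtop (quotient_mfd G M \<Gamma>))"

definition affine_automorphism ::
  "('g, 'r) monoid_scheme \<Rightarrow> ('g, 'e::real_normed_vector) mfd \<Rightarrow> 'g set \<Rightarrow> ('g set \<Rightarrow> 'g set) \<Rightarrow> bool" where
  "affine_automorphism G M \<Gamma> A \<longleftrightarrow>
     diffeo (quotient_mfd G M \<Gamma>) (quotient_mfd G M \<Gamma>) A \<and>
     (\<exists>g\<^sub>0\<in>carrier G. \<exists>\<Phi>. lie_group_automorphism G M \<Phi> \<and>
        (\<lambda>\<gamma>. g\<^sub>0 \<otimes>\<^bsub>G\<^esub> \<Phi> \<gamma> \<otimes>\<^bsub>G\<^esub> inv\<^bsub>G\<^esub> g\<^sub>0) ` \<Gamma> = \<Gamma> \<and>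
        (\<forall>g\<in>carrier G. A (\<Gamma> #>\<^bsub>G\<^esub> g) = \<Gamma> #>\<^bsub>G\<^esub> (g\<^sub>0 \<otimes>\<^bsub>G\<^esub> \<Phi> g)))"

section \<open>The trivialization by left-invariant vector fields\<close>

text \<open>
  The Lie algebra is the tangent space \<open>'e\<close> of \<open>G\<close> at the identity. The element \<open>v\<close> extends to
  the left-invariant field with value \<open>left_field G M g v\<close> at \<open>g\<close>, and
  \<open>quotient_field G M \<Gamma> g v\<close> is the value of the descended field at \<open>\<Gamma>g\<close>.
\<close>

definition left_field ::
  "('g, 'r) monoid_scheme \<Rightarrow> ('g, 'e::real_normed_vector) mfd \<Rightarrow> 'g \<Rightarrow> ('e \<Rightarrow>\<^sub>L 'e)" where
  "left_field G M g = tangent_map M M (\<lambda>h. g \<otimes>\<^bsub>G\<^esub> h) \<one>\<^bsub>G\<^esub>"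

definition quotient_field ::
  "('g, 'r) monoid_scheme \<Rightarrow> ('g, 'e::real_normed_vector) mfd \<Rightarrow> 'g set \<Rightarrow> 'g \<Rightarrow> ('e \<Rightarrow>\<^sub>L 'e)" where
  "quotient_field G M \<Gamma> g =
     tangent_map M (quotient_mfd G M \<Gamma>) ((#>\<^bsub>G\<^esub>) \<Gamma>) g o\<^sub>L left_field G M g"

text \<open>
  The bundle endomorphism \<open>J\<close> of the tangent bundle of \<open>\<Gamma>\G\<close> corresponds to the map \<open>F\<close> into the
  endomorphisms of the Lie algebra:
\<close>

definition represents ::
  "('g, 'r) monoid_scheme \<Rightarrow> ('g, 'e::real_normed_vector) mfd \<Rightarrow> 'g set \<Rightarrow>
   ('g set \<Rightarrow> ('e \<Rightarrow>\<^sub>L 'e)) \<Rightarrow> ('g set \<Rightarrow> ('e \<Rightarrow>\<^sub>L 'e)) \<Rightarrow> bool" where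
  "represents G M \<Gamma> F J \<longleftrightarrow>
     (\<forall>g\<in>carrier G. J (\<Gamma> #>\<^bsub>G\<^esub> g) o\<^sub>L quotient_field G M \<Gamma> g =
                      quotient_field G M \<Gamma> g o\<^sub>L F (\<Gamma> #>\<^bsub>G\<^esub> g))"

definition left_invariant ::
  "('g, 'r) monoid_scheme \<Rightarrow> ('g, 'e::real_normed_vector) mfd \<Rightarrow> 'g set \<Rightarrow>
   ('g set \<Rightarrow> ('e \<Rightarrow>\<^sub>L 'e)) \<Rightarrow> bool" where
  "left_invariant G M \<Gamma> J \<longleftrightarrow> (\<exists>T. represents G M \<Gamma> (\<lambda>_. T) J)"

section \<open>Ergodicity and weak mixing\<close>

definition measure_preserving :: "'a measure \<Rightarrow> ('a \<Rightarrow> 'a) \<Rightarrow> bool" where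
  "measure_preserving m A \<longleftrightarrow> A \<in> measurable m m \<and> distr m m A = m"

definition ergodic :: "'a measure \<Rightarrow> ('a \<Rightarrow> 'a) \<Rightarrow> bool" where
  "ergodic m A \<longleftrightarrow> measure_preserving m A \<and>
     (\<forall>S\<in>sets m. A -` S \<inter> space m = S \<longrightarrow> measure m S = 0 \<or> measure m S = 1)"

definition weakly_mixing :: "'a measure \<Rightarrow> ('a \<Rightarrow> 'a) \<Rightarrow> bool" where
  "weakly_mixing m A \<longleftrightarrow> measure_preserving m A \<and>
     (\<forall>S\<in>sets m. \<forall>T\<in>sets m.
        (\<lambda>n. (\<Sum>k<n. \<bar>measure m (((A ^^ k) -` S \<inter> space m) \<inter> T) - measure m S * measure m T\<bar>) / real n)
          \<longlonglongrightarrow> 0)"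

end

theory Submission
  imports Defs
begin

text \<open>
  In the trivialization by left-invariant fields, a bundle endomorphism \<open>J\<close> of \<open>T(\<Gamma>\G)\<close> becomes a map
  \<open>F\<close> into the endomorphisms of the Lie algebra. The affine automorphism \<open>A\<close>, induced by
  \<open>g \<mapsto> g\<^sub>0\<Phi>(g)\<close>, has in this trivialization the constant derivative \<open>L = D\<Phi>(1)\<close>, because
  \<open>g\<^sub>0\<Phi>(gh) = g\<^sub>0\<Phi>(g)\<Phi>(h)\<close>. So \<open>J\<close> is \<open>A\<close>-invariant iff \<open>F(Ax) L = L F(x)\<close>, that is, iff
  \<open>F \<circ> A = T \<circ> F\<close> for the linear map \<open>T w = L w L\<inverse>\<close> of a finite-dimensional space. The corollary is
  a statement about continuous solutions \<open>F\<close> of this equation.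

  If \<open>A\<close> is ergodic, some point \<open>x\<^sub>0\<close> has a dense orbit, as the Haar measure charges every nonempty
  open set. A solution that vanishes at \<open>x\<^sub>0\<close> vanishes on the orbit, hence everywhere. So evaluation
  at \<open>x\<^sub>0\<close> is injective on the space of all smooth solutions, whose dimension is therefore at most
  that of the endomorphisms of the Lie algebra (\<open>ergodic_equivariant_fin_dim\<close>).

  If \<open>A\<close> is weakly mixing, let \<open>F\<close> be a solution. Its image \<open>K\<close> is compact and \<open>T\<close> maps \<open>K\<close> onto
  itself, so the powers of \<open>T\<close>, positive and negative, are uniformly bounded on the span of \<open>K\<close>: \<open>T\<close>
  is an isometry up to a constant. If \<open>F(p) \<noteq> F(q)\<close>, let \<open>S\<close> and \<open>S'\<close> be the preimages of small balls
  around \<open>F(p)\<close> and \<open>F(q)\<close>. The image under \<open>F\<close> of \<open>A\<^sup>-\<^sup>k S\<close> is too small to meet both balls, so for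
  each \<open>k\<close> the set \<open>A\<^sup>-\<^sup>k S\<close> is disjoint from \<open>S\<close> or from \<open>S'\<close>, both of positive measure, which
  weak mixing forbids (\<open>weakly_mixing_equivariant_constant\<close>). So \<open>F\<close> is constant.

  The geometric part consists in showing that \<open>F\<close> exists, is smooth and satisfies the equation
  (\<open>representative_exists\<close>, \<open>representative_smooth\<close>, \<open>representative_equivariant\<close>). It rests on a
  chain rule for derivatives read in charts (\<open>smooth_near_compose\<close>) and on the smoothness of the
  partial derivatives of the group operations (\<open>smooth_partial_coord_deriv\<close>).
\<close>

section \<open>Finite-dimensional normed spaces\<close>

text \<open>
  A vector \<open>a\<close> outside the span of \<open>B\<close> has a positive distance \<open>\<delta>\<close> from it: by the induction
  hypothesis the coordinates of a sequence in the span that tends to \<open>a\<close> are Cauchy, so the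
  limit would lie in the span. This bounds the coordinate along \<open>a\<close>, and then all others. The
  bound takes the place of the equivalence of norms.
\<close>
lemma independent_coordinates_bounded:
  fixes B :: "'a::real_normed_vector set"
  assumes "finite B" "independent B"
  shows "\<exists>C. \<forall>c. \<forall>b\<in>B. \<bar>c b\<bar> \<le> C * norm (\<Sum>b\<in>B. c b *\<^sub>R b)"
  using assms
proof (induction B)
  case empty
  then show ?case by simp
next
  case (insert a B)
  have ind: "independent B" and a: "a \<notin> span B"
    using insert.prems insert.hyps independent_insert[of a B] by auto
  obtain C where C: "\<And>c b. b \<in> B \<Longrightarrow> \<bar>c b\<bar> \<le> C * norm (\<Sum>b\<in>B. c b *\<^sub>R b)"
    using insert.IH[OF ind] by blast
  have "\<exists>\<delta>>0. \<forall>c. norm (a - (\<Sum>b\<in>B. c b *\<^sub>R b)) \<ge> \<delta>"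
  proof (rule ccontr)
    assume "\<not> ?thesis"
    then have "\<forall>n. \<exists>c. norm (a - (\<Sum>b\<in>B. c b *\<^sub>R b)) < 1 / real (Suc n)"
      by (meson not_less of_nat_0_less_iff zero_less_Suc zero_less_divide_1_iff)
    then obtain c where c: "\<And>n. norm (a - (\<Sum>b\<in>B. c n b *\<^sub>R b)) < 1 / real (Suc n)"
      by metis
    let ?s = "\<lambda>n. \<Sum>b\<in>B. c n b *\<^sub>R b"
    have "(\<lambda>n. a - ?s n) \<longlonglongrightarrow> 0"
    proof (rule Lim_null_comparison)
      show "\<forall>\<^sub>F n in sequentially. norm (a - ?s n) \<le> 1 / real (Suc n)"
        using c by (simp add: less_imp_le)
      show "(\<lambda>n. 1 / real (Suc n)) \<longlonglongrightarrow> 0"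
        by (rule LIMSEQ_Suc[OF lim_1_over_n])
    qed
    then have lim: "?s \<longlonglongrightarrow> a"
      using tendsto_diff[OF tendsto_const[of a]] by fastforce
    then have Cs: "Cauchy ?s"
      by (rule LIMSEQ_imp_Cauchy)
    have "convergent (\<lambda>n. c n b)" if b: "b \<in> B" for b
    proof -
      have "Cauchy (\<lambda>n. c n b)"
      proof (rule metric_CauchyI)
        fix e :: real
        assume "e > 0"
        then have "e / (\<bar>C\<bar> + 1) > 0" by simp
        then obtain N where N: "\<And>m n. m \<ge> N \<Longrightarrow> n \<ge> N \<Longrightarrow> dist (?s m) (?s n) < e / (\<bar>C\<bar> + 1)"
          using metric_CauchyD[OF Cs] by meson
        have "dist (c m b) (c n b) < e" if "m \<ge> N" "n \<ge> N" for m n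
        proof -
          have "\<bar>c m b - c n b\<bar> \<le> C * norm (\<Sum>b\<in>B. (c m b - c n b) *\<^sub>R b)"
            using C[OF b, of "\<lambda>b. c m b - c n b"] .
          also have "\<dots> = C * dist (?s m) (?s n)"
            by (simp add: scaleR_diff_left sum_subtractf dist_norm)
          also have "\<dots> \<le> (\<bar>C\<bar> + 1) * dist (?s m) (?s n)"
            by (intro mult_right_mono) auto
          also have "\<dots> < e"
            using N[OF that] by (simp add: field_simps)
          finally show ?thesis by (simp add: dist_real_def)
        qed
        then show "\<exists>M. \<forall>m\<ge>M. \<forall>n\<ge>M. dist (c m b) (c n b) < e" by blast
      qed
      then show ?thesis by (simp add: Cauchy_convergent_iff)
    qed
    then obtain l where l: "\<And>b. b \<in> B \<Longrightarrow> (\<lambda>n. c n b) \<longlonglongrightarrow> l b"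
      unfolding convergent_def by metis
    have "?s \<longlonglongrightarrow> (\<Sum>b\<in>B. l b *\<^sub>R b)"
      by (intro tendsto_sum tendsto_scaleR l tendsto_const)
    then have "a = (\<Sum>b\<in>B. l b *\<^sub>R b)"
      using lim LIMSEQ_unique by blast
    then have "a \<in> span B"
      by (simp add: span_sum span_scale span_base)
    then show False using a by simp
  qed
  then obtain \<delta> where \<delta>: "\<delta> > 0" "\<And>c. norm (a - (\<Sum>b\<in>B. c b *\<^sub>R b)) \<ge> \<delta>" by blast
  \<comment> \<open>The first summand bounds the coordinate along \<open>a\<close>, the second the remaining ones.\<close>
  let ?C = "1 / \<delta> + \<bar>C\<bar> * (1 + norm a / \<delta>)"
  have "\<bar>c b\<bar> \<le> ?C * norm (\<Sum>b\<in>insert a B. c b *\<^sub>R b)" if b: "b \<in> insert a B" for c b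
  proof -
    define v where "v = (\<Sum>b\<in>insert a B. c b *\<^sub>R b)"
    have v: "v = c a *\<^sub>R a + (\<Sum>b\<in>B. c b *\<^sub>R b)"
      using insert.hyps by (simp add: v_def)
    have ca: "\<bar>c a\<bar> \<le> norm v / \<delta>"
    proof (cases "c a = 0")
      case False
      have "v = c a *\<^sub>R (a - (\<Sum>b\<in>B. (- c b / c a) *\<^sub>R b))"
        using False by (simp add: v scaleR_add_right scaleR_sum_right sum_negf)
      then have "norm v = \<bar>c a\<bar> * norm (a - (\<Sum>b\<in>B. (- c b / c a) *\<^sub>R b))"
        by (metis norm_scaleR)
      also have "\<dots> \<ge> \<bar>c a\<bar> * \<delta>"
        by (intro mult_left_mono \<delta>(2)) auto
      finally show ?thesis using \<delta>(1) by (simp add: field_simps)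
    qed (use \<delta>(1) in auto)
    have cb: "\<bar>c b\<bar> \<le> \<bar>C\<bar> * (1 + norm a / \<delta>) * norm v" if "b \<in> B"
    proof -
      have "\<bar>c b\<bar> \<le> C * norm (\<Sum>b\<in>B. c b *\<^sub>R b)" by (rule C[OF that])
      also have "\<dots> \<le> \<bar>C\<bar> * norm (v - c a *\<^sub>R a)"
        unfolding v by (simp add: mult_right_mono)
      also have "\<dots> \<le> \<bar>C\<bar> * (norm v + \<bar>c a\<bar> * norm a)"
        by (intro mult_left_mono) (metis norm_triangle_ineq4 norm_scaleR, simp)
      also have "\<dots> \<le> \<bar>C\<bar> * (norm v + norm v / \<delta> * norm a)"
        by (intro mult_left_mono add_left_mono mult_right_mono ca) auto
      also have "\<dots> = \<bar>C\<bar> * (1 + norm a / \<delta>) * norm v"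
        by (simp add: algebra_simps)
      finally show ?thesis .
    qed
    have "norm v / \<delta> \<ge> 0" "\<bar>C\<bar> * (1 + norm a / \<delta>) * norm v \<ge> 0" using \<delta>(1) by auto
    then show ?thesis
      using b ca cb unfolding v_def[symmetric] by (auto simp: distrib_right)
  qed
  then show ?case by blast
qed

text \<open>
  The model space of a manifold is known only to be spanned by a finite set, so finite
  dimension is a predicate here and not a type class.
\<close>
definition fin_dim :: "'a::real_vector set \<Rightarrow> bool" where
  "fin_dim V \<longleftrightarrow> (\<exists>B. finite B \<and> V \<subseteq> span B)"

lemma fin_dim_independent_finite:
  assumes "fin_dim V" "independent S" "S \<subseteq> V"
  shows "finite S"
  using assms independent_span_bound unfolding fin_dim_def by (meson order_trans)

lemma fin_dim_basis:
  assumes "fin_dim V"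
  obtains B where "finite B" "independent B" "B \<subseteq> V" "V \<subseteq> span B"
proof -
  obtain B where B: "B \<subseteq> V" "independent B" "V \<subseteq> span B"
    using maximal_independent_subset[of V] by blast
  show ?thesis
    by (rule that[OF fin_dim_independent_finite[OF assms B(2,1)] B(2,1,3)])
qed

lemma fin_dim_coordinates:
  assumes "fin_dim (UNIV :: 'a::real_normed_vector set)"
  obtains B and k :: "'a::real_normed_vector \<Rightarrow> 'a \<Rightarrow>\<^sub>L real"
  where "finite B" "\<And>v. v = (\<Sum>b\<in>B. k b v *\<^sub>R b)"
proof -
  obtain B :: "'a set" where B: "finite B" "independent B" and "UNIV \<subseteq> span B"
    using fin_dim_basis[OF assms] .
  then have sp: "span B = UNIV" by (simp add: top.extremum_unique)
  obtain C where C: "\<And>c b. b \<in> B \<Longrightarrow> \<bar>c b\<bar> \<le> C * norm (\<Sum>b\<in>B. c b *\<^sub>R b)"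
    using independent_coordinates_bounded[OF B] by blast
  let ?r = "\<lambda>b v. representation B v b"
  have sum: "(\<Sum>b\<in>B. ?r b v *\<^sub>R b) = v" for v
    using sum_representation_eq[of B v B] B sp by auto
  have lin: "bounded_linear (?r b)" if "b \<in> B" for b
  proof (rule bounded_linear_intro)
    show "?r b (x + y) = ?r b x + ?r b y" for x y
      using representation_add[of B y x] B sp by simp
    show "?r b (r *\<^sub>R x) = r *\<^sub>R ?r b x" for r x
      using representation_scale[of B x r] B sp by simp
    show "norm (?r b x) \<le> norm x * C" for x
      using C[OF that, of "\<lambda>b. ?r b x"] by (simp add: sum mult.commute)
  qed
  have "v = (\<Sum>b\<in>B. Blinfun (?r b) v *\<^sub>R b)" for v
    using sum[of v] lin by (simp add: bounded_linear_Blinfun_apply)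
  with B(1) show ?thesis by (rule that)
qed

lemma fin_dim_Times:
  assumes "fin_dim (UNIV :: 'a::real_vector set)" "fin_dim (UNIV :: 'b::real_vector set)"
  shows "fin_dim (UNIV :: ('a::real_vector \<times> 'b::real_vector) set)"
proof -
  obtain B :: "'a set" where B: "finite B" "UNIV \<subseteq> span B" using assms(1) unfolding fin_dim_def by blast
  obtain C :: "'b set" where C: "finite C" "UNIV \<subseteq> span C" using assms(2) unfolding fin_dim_def by blast
  let ?D = "(\<lambda>b. (b, 0)) ` B \<union> (\<lambda>c. (0, c)) ` C"
  have l1: "linear (\<lambda>b::'a. (b, 0::'b))" and l2: "linear (\<lambda>c::'b. (0::'a, c))"
    by (auto intro!: linearI)
  have "(x, y) \<in> span ?D" for x y
  proof -
    have "(x, 0) \<in> span ?D"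
      using B(2) linear_span_image[OF l1, of B] span_mono[of "(\<lambda>b. (b, 0)) ` B" ?D] by blast
    moreover have "(0, y) \<in> span ?D"
      using C(2) linear_span_image[OF l2, of C] span_mono[of "(\<lambda>c. (0, c)) ` C" ?D] by blast
    ultimately have "(x, 0) + (0, y) \<in> span ?D" by (rule span_add)
    then show ?thesis by simp
  qed
  then have "UNIV \<subseteq> span ?D" by auto
  moreover have "finite ?D" using B C by simp
  ultimately show ?thesis unfolding fin_dim_def by blast
qed

definition rank_one :: "('a::real_normed_vector \<Rightarrow>\<^sub>L real) \<Rightarrow> 'b::real_normed_vector \<Rightarrow> 'a \<Rightarrow>\<^sub>L 'b" where
  "rank_one k w = blinfun_scaleR_left w o\<^sub>L k"

lemma rank_one_apply [simp]: "rank_one k w v = k v *\<^sub>R w"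
  by (simp add: rank_one_def)

lemma bounded_linear_rank_one:
  "bounded_linear (rank_one k :: 'b::real_normed_vector \<Rightarrow> 'a::real_normed_vector \<Rightarrow>\<^sub>L 'b)"
proof (rule bounded_linear_intro)
  show "rank_one k (x + y) = rank_one k x + rank_one k y" for x y :: 'b
    by (rule blinfun_eqI) (simp add: blinfun.add_left scaleR_add_right)
  show "rank_one k (r *\<^sub>R x) = r *\<^sub>R rank_one k x" for r and x :: 'b
    by (rule blinfun_eqI) (simp add: blinfun.scaleR_left)
  show "norm (rank_one k x) \<le> norm x * norm k" for x :: 'b
  proof (rule norm_blinfun_bound)
    fix v
    have "\<bar>k v\<bar> * norm x \<le> norm k * norm v * norm x"
      using norm_blinfun[of k v] by (intro mult_right_mono) auto
    then show "norm (rank_one k x v) \<le> norm x * norm k * norm v" by (simp add: mult_ac)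
  qed simp
qed

text \<open>
  Through this expansion an operator inherits from its values on a basis both smoothness in a
  parameter and membership in a finite-dimensional space.
\<close>
lemma blinfun_sum_rank_one:
  fixes R :: "'a::real_normed_vector \<Rightarrow>\<^sub>L 'b::real_normed_vector"
  assumes "\<And>v. v = (\<Sum>b\<in>B. blinfun_apply (k b) v *\<^sub>R b)"
  shows "R = (\<Sum>b\<in>B. rank_one (k b) (R b))"
proof (rule blinfun_eqI)
  fix v
  have "R v = R (\<Sum>b\<in>B. k b v *\<^sub>R b)" using assms[of v] by simp
  then show "R v = (\<Sum>b\<in>B. rank_one (k b) (R b)) v"
    by (simp add: blinfun.sum_left blinfun.sum_right blinfun.scaleR_right)
qed

lemma fin_dim_blinfun:
  assumes "fin_dim (UNIV :: 'a::real_normed_vector set)" "fin_dim (UNIV :: 'b::real_normed_vector set)"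
  shows "fin_dim (UNIV :: ('a::real_normed_vector \<Rightarrow>\<^sub>L 'b::real_normed_vector) set)"
proof -
  obtain B and k :: "'a \<Rightarrow> 'a \<Rightarrow>\<^sub>L real" where B: "finite B" "\<And>v. v = (\<Sum>b\<in>B. k b v *\<^sub>R b)"
    using fin_dim_coordinates[OF assms(1)] by blast
  obtain C and l :: "'b \<Rightarrow> 'b \<Rightarrow>\<^sub>L real" where C: "finite C" "\<And>v. v = (\<Sum>c\<in>C. l c v *\<^sub>R c)"
    using fin_dim_coordinates[OF assms(2)] by blast
  let ?D = "(\<lambda>(b, c). rank_one (k b) c) ` (B \<times> C)"
  have "R \<in> span ?D" for R :: "'a \<Rightarrow>\<^sub>L 'b"
  proof -
    have "R = (\<Sum>b\<in>B. rank_one (k b) (R b))" by (rule blinfun_sum_rank_one) (rule B)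
    also have "\<dots> = (\<Sum>b\<in>B. \<Sum>c\<in>C. l c (R b) *\<^sub>R rank_one (k b) c)"
    proof (rule sum.cong[OF refl])
      fix b
      interpret r: bounded_linear "rank_one (k b) :: 'b \<Rightarrow> _" by (rule bounded_linear_rank_one)
      have "rank_one (k b) (R b) = rank_one (k b) (\<Sum>c\<in>C. l c (R b) *\<^sub>R c)"
        using C(2)[of "R b"] by simp
      then show "rank_one (k b) (R b) = (\<Sum>c\<in>C. l c (R b) *\<^sub>R rank_one (k b) c)"
        by (simp add: r.sum r.scaleR)
    qed
    also have "\<dots> \<in> span ?D"
      by (intro span_sum span_scale span_base) auto
    finally show ?thesis .
  qed
  moreover have "finite ?D" using B C by simp
  ultimately show ?thesis unfolding fin_dim_def by blast
qed

section \<open>Calculus of smooth functions\<close>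

lemma Ck_on_cong:
  assumes "open S" "\<And>x. x \<in> S \<Longrightarrow> f x = g x" "Ck_on k f S"
  shows "Ck_on k g S"
  using assms(2,3)
proof (induction k arbitrary: f g)
  case 0
  then show ?case by (auto cong: continuous_on_cong)
next
  case (Suc k)
  have d: "g differentiable at x" "frechet_derivative f (at x) = frechet_derivative g (at x)"
    if "x \<in> S" for x
  proof -
    have "f differentiable at x" using Suc.prems that by simp
    then show "frechet_derivative f (at x) = frechet_derivative g (at x)"
      by (rule frechet_derivative_transform_within_open) (use assms(1) that Suc.prems in auto)
    show "g differentiable at x"
      using \<open>f differentiable at x\<close> has_derivative_transform_within_open[OF _ assms(1) that] Suc.prems(1)
      unfolding differentiable_def by metis
  qed
  have "Ck_on k (\<lambda>x. frechet_derivative g (at x) v) S" for v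
    by (rule Suc.IH[of "\<lambda>x. frechet_derivative f (at x) v"]) (use d Suc.prems in auto)
  then show ?case using d by simp
qed

lemma Ck_on_subset: "Ck_on k f S \<Longrightarrow> T \<subseteq> S \<Longrightarrow> Ck_on k f T"
  by (induction k arbitrary: f) (auto intro: continuous_on_subset)

lemma Ck_on_Union:
  assumes "\<And>T. T \<in> \<T> \<Longrightarrow> open T" "\<And>T. T \<in> \<T> \<Longrightarrow> Ck_on k f T"
  shows "Ck_on k f (\<Union>\<T>)"
  using assms(2)
proof (induction k arbitrary: f)
  case 0
  then show ?case using continuous_on_open_Union[of \<T> f] assms(1) by simp
qed auto

lemma Ck_on_SucD: "Ck_on (Suc k) f S \<Longrightarrow> Ck_on k f S"
proof (induction k arbitrary: f)
  case 0
  then show ?case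
    by (auto intro!: continuous_at_imp_continuous_on differentiable_imp_continuous_within)
next
  case (Suc k)
  then show ?case by auto
qed

lemma Ck_on_SucI:
  assumes "open S" "\<And>x. x \<in> S \<Longrightarrow> (f has_derivative D x) (at x)" "\<And>v. Ck_on k (\<lambda>x. D x v) S"
  shows "Ck_on (Suc k) f S"
proof -
  have "frechet_derivative f (at x) = D x" if "x \<in> S" for x
    using frechet_derivative_at[OF assms(2)[OF that]] by simp
  then have "Ck_on k (\<lambda>x. frechet_derivative f (at x) v) S" for v
    by (intro Ck_on_cong[OF assms(1) _ assms(3)[of v]]) simp
  then show ?thesis using assms(2) by (auto simp: differentiable_def)
qed

lemma Ck_on_SucE:
  assumes "Ck_on (Suc k) f S"
  shows "x \<in> S \<Longrightarrow> (f has_derivative frechet_derivative f (at x)) (at x)"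
    "Ck_on k (\<lambda>x. frechet_derivative f (at x) v) S"
  using assms by (auto simp: frechet_derivative_works)

lemma Ck_on_const: "Ck_on k (\<lambda>x. c) S"
  by (induction k arbitrary: c) auto

lemma Ck_on_bounded_linear: "open S \<Longrightarrow> bounded_linear f \<Longrightarrow> Ck_on k f S"
proof (induction k)
  case 0
  then show ?case by (simp add: linear_continuous_on)
next
  case (Suc k)
  show ?case
    by (rule Ck_on_SucI[where D = "\<lambda>x. f"])
       (use Suc.prems in \<open>auto intro: bounded_linear_imp_has_derivative Ck_on_const\<close>)
qed

lemma Ck_on_add:
  assumes "open S" "Ck_on k f S" "Ck_on k g S"
  shows "Ck_on k (\<lambda>x. f x + g x) S"
  using assms(2,3)
proof (induction k arbitrary: f g)
  case 0
  then show ?case by (auto intro: continuous_intros)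
next
  case (Suc k)
  show ?case
    by (rule Ck_on_SucI[OF assms(1) has_derivative_add[OF Ck_on_SucE(1)[OF Suc.prems(1)] Ck_on_SucE(1)[OF Suc.prems(2)]]])
       (intro Suc.IH Ck_on_SucE(2) Suc.prems | assumption)+
qed

lemma Ck_on_sum:
  assumes "open S" "\<And>i. i \<in> I \<Longrightarrow> Ck_on k (f i) S"
  shows "Ck_on k (\<lambda>x. \<Sum>i\<in>I. f i x) S"
  using assms(2)
  by (induction I rule: infinite_finite_induct) (auto intro: Ck_on_const Ck_on_add[OF assms(1)])

lemma Ck_on_bilinear:
  assumes "open S" "bounded_bilinear p" "Ck_on k f S" "Ck_on k g S"
  shows "Ck_on k (\<lambda>x. p (f x) (g x)) S"
  using assms(3,4)
proof (induction k arbitrary: f g)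
  case 0
  then show ?case using bounded_bilinear.continuous_on[OF assms(2)] by auto
next
  case (Suc k)
  show ?case
  proof (rule Ck_on_SucI[OF assms(1) bounded_bilinear.FDERIV[OF assms(2)]])
    show "(f has_derivative frechet_derivative f (at x)) (at x)" if "x \<in> S" for x
      using Suc.prems(1) that by (rule Ck_on_SucE)
    show "(g has_derivative frechet_derivative g (at x)) (at x)" if "x \<in> S" for x
      using Suc.prems(2) that by (rule Ck_on_SucE)
    show "Ck_on k (\<lambda>x. p (f x) (frechet_derivative g (at x) v) + p (frechet_derivative f (at x) v) (g x)) S"
      for v
      by (intro Ck_on_add[OF assms(1) Suc.IH Suc.IH] Ck_on_SucE(2)[OF Suc.prems(1)]
          Ck_on_SucE(2)[OF Suc.prems(2)] Ck_on_SucD[OF Suc.prems(1)] Ck_on_SucD[OF Suc.prems(2)])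
  qed
qed

lemma Ck_on_bounded_linear_compose:
  assumes "open S" "bounded_linear l" "Ck_on k f S"
  shows "Ck_on k (\<lambda>x. l (f x)) S"
  using assms(3)
proof (induction k arbitrary: f)
  case 0
  then show ?case using bounded_linear.continuous_on[OF assms(2)] by auto
next
  case (Suc k)
  show ?case
    by (rule Ck_on_SucI[OF assms(1) bounded_linear.has_derivative[OF assms(2) Ck_on_SucE(1)[OF Suc.prems]]])
       (intro Suc.IH Ck_on_SucE(2) Suc.prems | assumption)+
qed

lemma Ck_on_Pair:
  assumes "open S" "Ck_on k f S" "Ck_on k g S"
  shows "Ck_on k (\<lambda>x. (f x, g x)) S"
  using assms(2,3)
proof (induction k arbitrary: f g)
  case 0
  then show ?case by (auto intro: continuous_intros)
next
  case (Suc k)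
  show ?case
    by (rule Ck_on_SucI[OF assms(1) has_derivative_Pair[OF Ck_on_SucE(1)[OF Suc.prems(1)] Ck_on_SucE(1)[OF Suc.prems(2)]]])
       (intro Suc.IH Ck_on_SucE(2) Suc.prems | assumption)+
qed

text \<open>
  In the derivative \<open>g'(f x)(f'(x) v)\<close> both the operator and its argument depend on \<open>x\<close>. Expanding
  the argument in coordinates leaves products of a \<open>C\<^sup>k\<close> scalar and \<open>g'(f x) b\<close> with a fixed
  vector \<open>b\<close>, and to the latter the induction hypothesis applies.
\<close>
lemma Ck_on_compose:
  fixes f :: "'a::real_normed_vector \<Rightarrow> 'b::real_normed_vector"
  assumes fd: "fin_dim (UNIV :: 'b set)"
    and "open S" "open T" "f ` S \<subseteq> T" "Ck_on k f S" "Ck_on k g T"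
  shows "Ck_on k (\<lambda>x. g (f x)) S"
proof -
  obtain B and e :: "'b \<Rightarrow> 'b \<Rightarrow>\<^sub>L real" where B: "finite B" "\<And>v. v = (\<Sum>b\<in>B. e b v *\<^sub>R b)"
    using fin_dim_coordinates[OF fd] by blast
  show ?thesis
    using assms(5,6)
  proof (induction k arbitrary: g)
    case 0
    then show ?case using assms(4) by (auto intro: continuous_on_compose2)
  next
    case (Suc k)
    let ?f' = "\<lambda>x. frechet_derivative f (at x)" and ?g' = "\<lambda>x. frechet_derivative g (at x)"
    have g': "(g has_derivative ?g' y) (at y)" if "y \<in> T" for y
      using Suc.prems(2) that by (rule Ck_on_SucE)
    have "Ck_on (Suc k) (\<lambda>x. g (f x)) S"
    proof (rule Ck_on_SucI[OF assms(2)])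
      fix x assume x: "x \<in> S"
      have fx: "(f has_derivative ?f' x) (at x)"
        using Suc.prems(1) x by (rule Ck_on_SucE)
      have gx: "(g has_derivative ?g' (f x)) (at (f x))" using x assms(4) by (intro g') auto
      have "((\<lambda>x. g (f x)) has_derivative (\<lambda>v. ?g' (f x) (?f' x v))) (at x)"
        using has_derivative_compose[OF fx gx] by simp
      moreover have "?g' (f x) (?f' x v) = (\<Sum>b\<in>B. e b (?f' x v) *\<^sub>R ?g' (f x) b)" for v
      proof -
        interpret l: bounded_linear "?g' (f x)" using gx by (rule has_derivative_bounded_linear)
        have "?g' (f x) (?f' x v) = ?g' (f x) (\<Sum>b\<in>B. e b (?f' x v) *\<^sub>R b)"
          using B(2)[of "?f' x v"] by simp
        then show ?thesis by (simp add: l.sum l.scaleR)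
      qed
      ultimately show "((\<lambda>x. g (f x)) has_derivative (\<lambda>v. \<Sum>b\<in>B. e b (?f' x v) *\<^sub>R ?g' (f x) b)) (at x)"
        by simp
    next
      fix v
      show "Ck_on k (\<lambda>x. \<Sum>b\<in>B. e b (?f' x v) *\<^sub>R ?g' (f x) b) S"
      proof (intro Ck_on_sum[OF assms(2)] Ck_on_bilinear[OF assms(2) bounded_bilinear_scaleR])
        fix b
        show "Ck_on k (\<lambda>x. e b (?f' x v)) S"
          by (rule Ck_on_bounded_linear_compose[OF assms(2) blinfun.bounded_linear_right Ck_on_SucE(2)[OF Suc.prems(1)]])
        show "Ck_on k (\<lambda>x. ?g' (f x) b) S"
          using Ck_on_SucD[OF Suc.prems(1)] Ck_on_SucE(2)[OF Suc.prems(2)]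
          by (rule Suc.IH)
      qed
    qed
    then show ?case .
  qed
qed

lemma smooth_on_cong: "open S \<Longrightarrow> (\<And>x. x \<in> S \<Longrightarrow> f x = g x) \<Longrightarrow> smooth_on S f \<Longrightarrow> smooth_on S g"
  unfolding smooth_on_def using Ck_on_cong by blast

lemma smooth_on_subset: "smooth_on S f \<Longrightarrow> T \<subseteq> S \<Longrightarrow> smooth_on T f"
  unfolding smooth_on_def using Ck_on_subset by blast

lemma smooth_on_local:
  assumes "\<And>x. x \<in> S \<Longrightarrow> \<exists>T. open T \<and> x \<in> T \<and> smooth_on T f"
  shows "smooth_on S f"
proof -
  let ?\<T> = "{T. open T \<and> smooth_on T f}"
  have "smooth_on (\<Union>?\<T>) f"
    unfolding smooth_on_def by (intro allI Ck_on_Union) (auto simp: smooth_on_def)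
  then show ?thesis by (rule smooth_on_subset) (use assms in blast)
qed

lemma smooth_on_has_derivative:
  "smooth_on S f \<Longrightarrow> x \<in> S \<Longrightarrow> (f has_derivative frechet_derivative f (at x)) (at x)"
  unfolding smooth_on_def using Ck_on_SucE(1) by blast

lemma smooth_on_frechet_derivative: "smooth_on S f \<Longrightarrow> smooth_on S (\<lambda>x. frechet_derivative f (at x) v)"
  unfolding smooth_on_def using Ck_on_SucE(2) by blast

lemma smooth_on_continuous: "smooth_on S f \<Longrightarrow> continuous_on S f"
  unfolding smooth_on_def by (metis Ck_on.simps(1))

lemma smooth_on_compose:
  fixes f :: "'a::real_normed_vector \<Rightarrow> 'b::real_normed_vector"
  assumes "fin_dim (UNIV :: 'b set)" "open S" "open T" "f ` S \<subseteq> T" "smooth_on S f" "smooth_on T g"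
  shows "smooth_on S (\<lambda>x. g (f x))"
  using assms unfolding smooth_on_def by (auto intro: Ck_on_compose)

lemma smooth_on_Pair:
  "open S \<Longrightarrow> smooth_on S f \<Longrightarrow> smooth_on S g \<Longrightarrow> smooth_on S (\<lambda>x. (f x, g x))"
  unfolding smooth_on_def by (auto intro: Ck_on_Pair)

lemma smooth_on_bounded_linear: "open S \<Longrightarrow> bounded_linear f \<Longrightarrow> smooth_on S f"
  unfolding smooth_on_def by (auto intro: Ck_on_bounded_linear)

lemma smooth_on_const: "smooth_on S (\<lambda>x. c)"
  unfolding smooth_on_def by (auto intro: Ck_on_const)

lemma smooth_on_ident: "open S \<Longrightarrow> smooth_on S (\<lambda>x. x)"
  by (rule smooth_on_bounded_linear) (auto intro: bounded_linear_ident)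

lemma smooth_on_add: "open S \<Longrightarrow> smooth_on S f \<Longrightarrow> smooth_on S g \<Longrightarrow> smooth_on S (\<lambda>x. f x + g x)"
  unfolding smooth_on_def by (auto intro: Ck_on_add)

lemma smooth_on_scaleR: "open S \<Longrightarrow> smooth_on S f \<Longrightarrow> smooth_on S (\<lambda>x. r *\<^sub>R f x)"
  unfolding smooth_on_def by (auto intro: Ck_on_bounded_linear_compose bounded_linear_scaleR_right)

lemma smooth_on_blinfun_compose:
  "open S \<Longrightarrow> smooth_on S f \<Longrightarrow> smooth_on S g \<Longrightarrow> smooth_on S (\<lambda>x. f x o\<^sub>L g x)"
  unfolding smooth_on_def
  by (auto intro!: Ck_on_bilinear[where p = blinfun_compose] bounded_bilinear_blinfun_compose)

text \<open>
  Iterated derivatives are defined one direction at a time; this turns smoothness in each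
  direction into smoothness for the operator norm.
\<close>
lemma smooth_on_blinfunI:
  fixes R :: "'a::real_normed_vector \<Rightarrow> ('b::real_normed_vector \<Rightarrow>\<^sub>L 'c::real_normed_vector)"
  assumes "fin_dim (UNIV :: 'b set)" "open S" "\<And>v. smooth_on S (\<lambda>x. R x v)"
  shows "smooth_on S R"
proof -
  obtain B and k :: "'b \<Rightarrow> 'b \<Rightarrow>\<^sub>L real" where B: "finite B" "\<And>v. v = (\<Sum>b\<in>B. k b v *\<^sub>R b)"
    using fin_dim_coordinates[OF assms(1)] by blast
  have R: "R x = (\<Sum>b\<in>B. rank_one (k b) (R x b))" for x
    by (rule blinfun_sum_rank_one) (rule B)
  have "smooth_on S (\<lambda>x. \<Sum>b\<in>B. rank_one (k b) (R x b))"
    using assms(2,3) unfolding smooth_on_def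
    by (auto intro!: Ck_on_sum Ck_on_bounded_linear_compose[OF _ bounded_linear_rank_one])
  then show ?thesis using R by simp
qed

text \<open>
  The section \<open>\<kappa>\<close> lets the point of differentiation move with the parameter. A constant \<open>\<kappa>\<close> serves
  for the derivative of \<open>h \<mapsto> gh\<close> at the identity, \<open>\<kappa> y = y\<close> for that of \<open>h \<mapsto> g\<inverse>h\<close> at \<open>h = g\<close>.
\<close>
lemma smooth_on_partial_derivative:
  fixes h :: "'a::real_normed_vector \<times> 'b::real_normed_vector \<Rightarrow> 'c::real_normed_vector"
  assumes fd: "fin_dim (UNIV :: 'a set)" "fin_dim (UNIV :: 'b set)"
    and "open O1" "smooth_on O1 h" "open S" "smooth_on S \<kappa>" "\<And>y. y \<in> S \<Longrightarrow> (y, \<kappa> y) \<in> O1"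
  shows "smooth_on S (\<lambda>y. Blinfun (frechet_derivative (\<lambda>w. h (y, w)) (at (\<kappa> y))))"
    and "\<And>y. y \<in> S \<Longrightarrow> (\<lambda>w. h (y, w)) differentiable (at (\<kappa> y))"
proof -
  have hd: "((\<lambda>w. h (y, w)) has_derivative (\<lambda>v. frechet_derivative h (at (y, \<kappa> y)) (0, v))) (at (\<kappa> y))"
    if "y \<in> S" for y
  proof -
    have "((\<lambda>w. (y, w)) has_derivative (\<lambda>v. (0, v))) (at (\<kappa> y))"
      by (auto intro!: derivative_eq_intros)
    from has_derivative_compose[OF this smooth_on_has_derivative[OF assms(4) assms(7)[OF that]]]
    show ?thesis by simp
  qed
  show "(\<lambda>w. h (y, w)) differentiable (at (\<kappa> y))" if "y \<in> S" for y
    using hd[OF that] by (auto simp: differentiable_def)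
  let ?R = "\<lambda>y. Blinfun (frechet_derivative (\<lambda>w. h (y, w)) (at (\<kappa> y)))"
  show "smooth_on S ?R"
  proof (rule smooth_on_blinfunI[OF fd(2) assms(5)])
    fix v
    have eq: "frechet_derivative h (at (y, \<kappa> y)) (0, v) = ?R y v" if "y \<in> S" for y
    proof -
      have "frechet_derivative (\<lambda>w. h (y, w)) (at (\<kappa> y)) = (\<lambda>v. frechet_derivative h (at (y, \<kappa> y)) (0, v))"
        using frechet_derivative_at[OF hd[OF that]] by simp
      then show ?thesis
        using has_derivative_bounded_linear[OF hd[OF that]] by (simp add: bounded_linear_Blinfun_apply)
    qed
    have "smooth_on S (\<lambda>y. frechet_derivative h (at (y, \<kappa> y)) (0, v))"
    proof (rule smooth_on_compose[where g = "\<lambda>p. frechet_derivative h (at p) (0, v)"])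
      show "fin_dim (UNIV :: ('a \<times> 'b) set)" by (rule fin_dim_Times[OF fd])
      show "smooth_on S (\<lambda>y. (y, \<kappa> y))"
        by (intro smooth_on_Pair smooth_on_ident assms)
      show "smooth_on O1 (\<lambda>p. frechet_derivative h (at p) (0, v))"
        by (rule smooth_on_frechet_derivative[OF assms(4)])
    qed (use assms in auto)
    then show "smooth_on S (\<lambda>y. ?R y v)"
      by (rule smooth_on_cong[OF assms(5), rotated]) (rule eq)
  qed
qed

section \<open>Smooth maps read in charts\<close>

abbreviation inv_chart :: "('m, 'e) chart \<Rightarrow> 'e \<Rightarrow> 'm" where
  "inv_chart c \<equiv> inv_into (fst c) (snd c)"

text \<open>
  What a chart has to satisfy for derivatives read in it to make sense. Unlike the homeomorphism
  property of \<^const>\<open>is_chart\<close>, this passes to charts of products and quotients in a few lines.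
\<close>
definition coord_chart :: "'m topology \<Rightarrow> ('m, 'e::real_normed_vector) chart \<Rightarrow> bool" where
  "coord_chart X c \<longleftrightarrow> fst c \<subseteq> topspace X \<and> inj_on (snd c) (fst c) \<and>
     (\<forall>W. openin X W \<longrightarrow> open (snd c ` (fst c \<inter> W)))"

text \<open>
  Smoothness of \<open>f\<close> near the point \<open>x\<close>, with a witness \<open>S\<close> on which the coordinate expression of \<open>f\<close>
  involves only meaningful values of the charts. Without such a witness \<^const>\<open>coord_deriv\<close> could
  depend on the arbitrary values of a chart off its domain.
\<close>
definition smooth_near ::
  "('m, 'e::real_normed_vector) chart \<Rightarrow> ('n, 'f::real_normed_vector) chart \<Rightarrow> ('m \<Rightarrow> 'n) \<Rightarrow> 'm \<Rightarrow> bool" where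
  "smooth_near c d f x \<longleftrightarrow> x \<in> fst c \<and>
     (\<exists>S. open S \<and> snd c x \<in> S \<and> S \<subseteq> snd c ` fst c \<and> (\<forall>y\<in>S. f (inv_chart c y) \<in> fst d) \<and>
        smooth_on S (snd d \<circ> f \<circ> inv_chart c))"

lemma coord_chart_open_image: "coord_chart X c \<Longrightarrow> open (snd c ` fst c)"
  unfolding coord_chart_def by (metis inf.absorb1 openin_topspace)

lemma coord_chart_inj: "coord_chart X c \<Longrightarrow> inj_on (snd c) (fst c)"
  unfolding coord_chart_def by blast

lemma smooth_nearI:
  assumes "x \<in> fst c" "open S" "snd c x \<in> S" "S \<subseteq> snd c ` fst c"
    "\<And>y. y \<in> S \<Longrightarrow> f (inv_chart c y) \<in> fst d" "smooth_on S (snd d \<circ> f \<circ> inv_chart c)"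
  shows "smooth_near c d f x"
  using assms unfolding smooth_near_def by blast

lemma smooth_nearE:
  assumes "smooth_near c d f x"
  obtains S where "x \<in> fst c" "open S" "snd c x \<in> S" "S \<subseteq> snd c ` fst c"
    "\<And>y. y \<in> S \<Longrightarrow> f (inv_chart c y) \<in> fst d" "smooth_on S (snd d \<circ> f \<circ> inv_chart c)"
  using assms unfolding smooth_near_def by blast

lemma smooth_near_differentiable:
  assumes "smooth_near c d f x"
  shows "(snd d \<circ> f \<circ> inv_chart c has_derivative coord_deriv c d f x) (at (snd c x))"
proof -
  obtain S where S: "snd c x \<in> S" "smooth_on S (snd d \<circ> f \<circ> inv_chart c)"
    using assms by (rule smooth_nearE) (rule that)
  from smooth_on_has_derivative[OF S(2,1)] show ?thesis
    unfolding coord_deriv_def by (simp add: bounded_linear_Blinfun_apply has_derivative_bounded_linear)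
qed

lemma coord_derivI:
  assumes "(snd d \<circ> f \<circ> inv_chart c has_derivative D) (at (snd c x))"
  shows "coord_deriv c d f x = Blinfun D"
  unfolding coord_deriv_def using frechet_derivative_at[OF assms] by simp

lemma smooth_near_cong:
  assumes "smooth_near c d f x" "\<And>z. z \<in> fst c \<Longrightarrow> f z = g z"
  shows "smooth_near c d g x" "coord_deriv c d f x = coord_deriv c d g x"
proof -
  obtain S where S: "x \<in> fst c" "open S" "snd c x \<in> S" "S \<subseteq> snd c ` fst c"
    "\<And>y. y \<in> S \<Longrightarrow> f (inv_chart c y) \<in> fst d" "smooth_on S (snd d \<circ> f \<circ> inv_chart c)"
    using assms(1) by (rule smooth_nearE) (rule that)
  have eq: "f (inv_chart c y) = g (inv_chart c y)" if "y \<in> S" for y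
    using that S(4) by (intro assms(2) inv_into_into) auto
  show "smooth_near c d g x"
  proof (rule smooth_nearI[OF S(1-4)])
    show "g (inv_chart c y) \<in> fst d" if "y \<in> S" for y using S(5)[OF that] eq[OF that] by simp
    show "smooth_on S (snd d \<circ> g \<circ> inv_chart c)"
      by (rule smooth_on_cong[OF S(2) _ S(6)]) (simp add: eq)
  qed
  have "(snd d \<circ> g \<circ> inv_chart c has_derivative coord_deriv c d f x) (at (snd c x))"
    by (rule has_derivative_transform_within_open[OF smooth_near_differentiable[OF assms(1)] S(2,3)])
       (simp add: eq)
  from coord_derivI[OF this] show "coord_deriv c d f x = coord_deriv c d g x"
    by (simp add: blinfun_apply_inverse)
qed

text \<open>
  The coordinate expression of \<open>g \<circ> f\<close> is the composition of those of \<open>f\<close> and \<open>g\<close> only where \<open>f\<close> takes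
  values in the domain of the middle chart, hence the passage to the smaller set \<open>P\<close>.
  The identities between tangent maps below come from this chain rule.
\<close>
lemma smooth_near_compose:
  fixes d :: "('n, 'f::real_normed_vector) chart"
  assumes fd: "fin_dim (UNIV :: 'f set)"
    and inj: "inj_on (snd c) (fst c)" "inj_on (snd d) (fst d)"
    and f: "smooth_near c d f x" and g: "smooth_near d e g (f x)"
  shows "smooth_near c e (g \<circ> f) x"
    and "coord_deriv c e (g \<circ> f) x = coord_deriv d e g (f x) o\<^sub>L coord_deriv c d f x"
proof -
  let ?F = "snd d \<circ> f \<circ> inv_chart c" and ?G = "snd e \<circ> g \<circ> inv_chart d"
  obtain S where S: "x \<in> fst c" "open S" "snd c x \<in> S" "S \<subseteq> snd c ` fst c"
    "\<And>y. y \<in> S \<Longrightarrow> f (inv_chart c y) \<in> fst d" "smooth_on S ?F"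
    using f by (rule smooth_nearE) (rule that)
  obtain T where T: "open T" "snd d (f x) \<in> T" "T \<subseteq> snd d ` fst d"
    "\<And>y. y \<in> T \<Longrightarrow> g (inv_chart d y) \<in> fst e" "smooth_on T ?G"
    using g by (rule smooth_nearE) (rule that)
  define P where "P = ?F -` T \<inter> S"
  have P: "open P" unfolding P_def
    by (rule continuous_open_preimage[OF smooth_on_continuous[OF S(6)] S(2) T(1), unfolded Int_commute[of S]])
  have xx: "inv_chart c (snd c x) = x" using S(1) inj by simp
  have xP: "snd c x \<in> P" using S(3) T(2) xx by (simp add: P_def)
  have eq: "g (f (inv_chart c y)) = g (inv_chart d (?F y))" if "y \<in> P" for y
    using S(5)[of y] that inj(2) by (simp add: P_def)
  show "smooth_near c e (g \<circ> f) x"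
  proof (rule smooth_nearI[OF S(1) P xP])
    show "P \<subseteq> snd c ` fst c" using S(4) by (auto simp: P_def)
    show "(g \<circ> f) (inv_chart c y) \<in> fst e" if "y \<in> P" for y
      using T(4)[of "?F y"] that eq[OF that] by (simp add: P_def)
    have "smooth_on P (\<lambda>y. ?G (?F y))"
      by (rule smooth_on_compose[OF fd P T(1) _ smooth_on_subset[OF S(6)] T(5)]) (auto simp: P_def)
    then show "smooth_on P (snd e \<circ> (g \<circ> f) \<circ> inv_chart c)"
      by (rule smooth_on_cong[OF P, rotated]) (use eq in simp)
  qed
  have Fx: "?F (snd c x) = snd d (f x)" using xx by simp
  have "((\<lambda>y. ?G (?F y)) has_derivative (\<lambda>v. coord_deriv d e g (f x) (coord_deriv c d f x v))) (at (snd c x))"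
    by (rule has_derivative_compose[OF smooth_near_differentiable[OF f]])
       (use smooth_near_differentiable[OF g] in \<open>simp only: Fx\<close>)
  then have "(snd e \<circ> (g \<circ> f) \<circ> inv_chart c has_derivative
      (\<lambda>v. coord_deriv d e g (f x) (coord_deriv c d f x v))) (at (snd c x))"
    by (rule has_derivative_transform_within_open[OF _ P xP]) (use eq in simp)
  from coord_derivI[OF this]
  show "coord_deriv c e (g \<circ> f) x = coord_deriv d e g (f x) o\<^sub>L coord_deriv c d f x"
    by (simp add: blinfun_compose.abs_eq[symmetric] eq_onp_def blinfun_apply_inverse blinfun_compose_def o_def)
qed

lemma smooth_near_id:
  assumes "coord_chart X c" "x \<in> fst c"
  shows "smooth_near c c id x" "coord_deriv c c id x = id_blinfun"
proof -
  have eq: "y = (snd c \<circ> id \<circ> inv_chart c) y" if "y \<in> snd c ` fst c" for y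
    using that by (simp add: f_inv_into_f)
  show "smooth_near c c id x"
  proof (rule smooth_nearI[OF assms(2) coord_chart_open_image[OF assms(1)]])
    show "smooth_on (snd c ` fst c) (snd c \<circ> id \<circ> inv_chart c)"
      by (rule smooth_on_cong[OF _ eq smooth_on_ident]) (use coord_chart_open_image[OF assms(1)] in auto)
  qed (use assms(2) in \<open>auto simp: inv_into_into\<close>)
  have "((\<lambda>y. y) has_derivative (\<lambda>v. v)) (at (snd c x))" by (rule has_derivative_ident)
  then have "(snd c \<circ> id \<circ> inv_chart c has_derivative (\<lambda>v. v)) (at (snd c x))"
    by (rule has_derivative_transform_within_open[OF _ coord_chart_open_image[OF assms(1)]])
       (use eq assms in auto)
  from coord_derivI[OF this] show "coord_deriv c c id x = id_blinfun"
    by (simp add: id_blinfun_def)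
qed

lemma is_chart_coord_chart:
  assumes "is_chart X c"
  shows "coord_chart X c"
  unfolding coord_chart_def
proof (intro conjI allI impI)
  have h: "homeomorphic_map (subtopology X (fst c)) (top_of_set (snd c ` fst c)) (snd c)"
    and o: "openin X (fst c)" and op: "open (snd c ` fst c)"
    using assms unfolding is_chart_def by auto
  show "fst c \<subseteq> topspace X" using o by (rule openin_subset)
  then show "inj_on (snd c) (fst c)"
    using homeomorphic_imp_injective_map[OF h] by (simp add: inf_absorb2)
  fix W assume "openin X W"
  then have "openin (subtopology X (fst c)) (fst c \<inter> W)"
    by (simp add: openin_subtopology_Int2)
  then have "openin (top_of_set (snd c ` fst c)) (snd c ` (fst c \<inter> W))"
    using homeomorphic_imp_open_map[OF h] unfolding open_map_def by blast
  then show "open (snd c ` (fst c \<inter> W))" using op openin_open_eq by blast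
qed

lemma smooth_map_smooth_near:
  assumes "smooth_map M N f" "c \<in> atlas M" "d \<in> atlas N" "coord_chart (mtop M) c"
    "openin (mtop N) (fst d)" "x \<in> fst c" "f x \<in> fst d"
  shows "smooth_near c d f x"
proof -
  let ?W = "{z \<in> topspace (mtop M). f z \<in> fst d}"
  have sub: "fst c \<subseteq> topspace (mtop M)" and inj: "inj_on (snd c) (fst c)"
    using assms(4) unfolding coord_chart_def by auto
  have eq: "fst c \<inter> ?W = {z \<in> fst c. f z \<in> fst d}" using sub by auto
  have "openin (mtop M) ?W"
    using assms(1,5) unfolding smooth_map_def by (auto intro: openin_continuous_map_preimage)
  then have op: "open (snd c ` {z \<in> fst c. f z \<in> fst d})"
    using assms(4) unfolding coord_chart_def eq[symmetric] by blast
  show ?thesis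
  proof (rule smooth_nearI[OF assms(6) op])
    show "smooth_on (snd c ` {z \<in> fst c. f z \<in> fst d}) (snd d \<circ> f \<circ> inv_chart c)"
      using assms(1-3) unfolding smooth_map_def by blast
    show "f (inv_chart c y) \<in> fst d" if "y \<in> snd c ` {z \<in> fst c. f z \<in> fst d}" for y
      using that inj by auto
  qed (use assms in auto)
qed

lemma compatible_smooth_near:
  assumes "compatible c d" "coord_chart X c" "openin X (fst d)" "x \<in> fst c" "x \<in> fst d"
  shows "smooth_near c d id x"
proof (rule smooth_nearI[OF assms(4)])
  show "open (snd c ` (fst c \<inter> fst d))" using assms(2,3) unfolding coord_chart_def by blast
  show "smooth_on (snd c ` (fst c \<inter> fst d)) (snd d \<circ> id \<circ> inv_chart c)"
    using assms(1) unfolding compatible_def transition_def by simp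
  show "id (inv_chart c y) \<in> fst d" if "y \<in> snd c ` (fst c \<inter> fst d)" for y
    using that coord_chart_inj[OF assms(2)] by auto
qed (use assms in auto)

lemma compatible_sym: "compatible c d \<longleftrightarrow> compatible d c"
  unfolding compatible_def by (auto simp: Int_commute)

subsection \<open>Products\<close>

definition prod_chart :: "('m, 'e) chart \<Rightarrow> ('n, 'f) chart \<Rightarrow> ('m \<times> 'n, 'e \<times> 'f) chart" where
  "prod_chart c d = (fst c \<times> fst d, map_prod (snd c) (snd d))"

lemma fst_prod_chart [simp]: "fst (prod_chart c d) = fst c \<times> fst d"
  and snd_prod_chart [simp]: "snd (prod_chart c d) = map_prod (snd c) (snd d)"
  by (simp_all add: prod_chart_def)

lemma inj_prod_chart:
  "inj_on (snd c) (fst c) \<Longrightarrow> inj_on (snd d) (fst d) \<Longrightarrow> inj_on (snd (prod_chart c d)) (fst (prod_chart c d))"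
  by (simp add: map_prod_inj_on)

lemma image_prod_chart:
  "snd (prod_chart c d) ` fst (prod_chart c d) = (snd c ` fst c) \<times> (snd d ` fst d)"
  by (auto simp: image_iff)

lemma inv_prod_chart:
  assumes "inj_on (snd c) (fst c)" "inj_on (snd d) (fst d)" "u \<in> snd c ` fst c" "v \<in> snd d ` fst d"
  shows "inv_chart (prod_chart c d) (u, v) = (inv_chart c u, inv_chart d v)"
  using assms by (intro inv_into_f_eq inj_prod_chart) (auto simp: inv_into_into f_inv_into_f)

lemma coord_chart_prod:
  assumes "coord_chart X c" "coord_chart Y d"
  shows "coord_chart (prod_topology X Y) (prod_chart c d)"
  unfolding coord_chart_def
proof (intro conjI allI impI)
  show "fst (prod_chart c d) \<subseteq> topspace (prod_topology X Y)"
    using assms unfolding coord_chart_def by auto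
  show "inj_on (snd (prod_chart c d)) (fst (prod_chart c d))"
    using assms by (intro inj_prod_chart coord_chart_inj)
  fix W assume W: "openin (prod_topology X Y) W"
  show "open (snd (prod_chart c d) ` (fst (prod_chart c d) \<inter> W))" (is "open ?V")
  proof (subst open_subopen, intro ballI)
    fix z assume "z \<in> ?V"
    then obtain x y where xy: "x \<in> fst c" "y \<in> fst d" "(x, y) \<in> W" "z = (snd c x, snd d y)" by auto
    then obtain A B where AB: "openin X A" "openin Y B" "x \<in> A" "y \<in> B" "A \<times> B \<subseteq> W"
      using W unfolding openin_prod_topology_alt by meson
    have "open (snd c ` (fst c \<inter> A) \<times> snd d ` (fst d \<inter> B))"
      using assms AB unfolding coord_chart_def by (intro open_Times) auto
    moreover have "snd c ` (fst c \<inter> A) \<times> snd d ` (fst d \<inter> B) \<subseteq> ?V"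
    proof
      fix p assume "p \<in> snd c ` (fst c \<inter> A) \<times> snd d ` (fst d \<inter> B)"
      then obtain a b where "a \<in> fst c" "a \<in> A" "b \<in> fst d" "b \<in> B" "p = map_prod (snd c) (snd d) (a, b)" by auto
      then show "p \<in> ?V" using AB(5) by (auto simp del: map_prod_simp)
    qed
    ultimately show "\<exists>T. open T \<and> z \<in> T \<and> T \<subseteq> ?V"
      using xy AB by blast
  qed
qed

lemma smooth_near_map_prod:
  fixes c :: "('m, 'e::real_normed_vector) chart" and d :: "('n, 'f::real_normed_vector) chart"
  assumes fd: "fin_dim (UNIV :: 'e set)" "fin_dim (UNIV :: 'f set)"
    and inj: "inj_on (snd c) (fst c)" "inj_on (snd d) (fst d)"
    and f: "smooth_near c c' f x" and g: "smooth_near d d' g y"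
  shows "smooth_near (prod_chart c d) (prod_chart c' d') (map_prod f g) (x, y)"
proof -
  obtain S where S: "x \<in> fst c" "open S" "snd c x \<in> S" "S \<subseteq> snd c ` fst c"
    "\<And>y. y \<in> S \<Longrightarrow> f (inv_chart c y) \<in> fst c'" "smooth_on S (snd c' \<circ> f \<circ> inv_chart c)"
    using f by (rule smooth_nearE) (rule that)
  obtain T where T: "y \<in> fst d" "open T" "snd d y \<in> T" "T \<subseteq> snd d ` fst d"
    "\<And>y. y \<in> T \<Longrightarrow> g (inv_chart d y) \<in> fst d'" "smooth_on T (snd d' \<circ> g \<circ> inv_chart d)"
    using g by (rule smooth_nearE) (rule that)
  have op: "open (S \<times> T)" using S T by (intro open_Times)
  have inv: "inv_chart (prod_chart c d) p = (inv_chart c (fst p), inv_chart d (snd p))" if "p \<in> S \<times> T" for p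
  proof -
    have "inv_chart (prod_chart c d) (fst p, snd p) = (inv_chart c (fst p), inv_chart d (snd p))"
      by (rule inv_prod_chart[OF inj]) (use that S(4) T(4) in auto)
    then show ?thesis by (simp only: prod.collapse)
  qed
  show ?thesis
  proof (rule smooth_nearI[of _ _ "S \<times> T"])
    show "map_prod f g (inv_chart (prod_chart c d) p) \<in> fst (prod_chart c' d')" if "p \<in> S \<times> T" for p
      using that S(5) T(5) inv[OF that] by auto
    have "smooth_on (S \<times> T) (\<lambda>p. ((snd c' \<circ> f \<circ> inv_chart c) (fst p), (snd d' \<circ> g \<circ> inv_chart d) (snd p)))"
    proof (rule smooth_on_Pair[OF op])
      show "smooth_on (S \<times> T) (\<lambda>p. (snd c' \<circ> f \<circ> inv_chart c) (fst p))"
        by (rule smooth_on_compose[OF fd(1) op S(2) _ smooth_on_bounded_linear[OF op bounded_linear_fst] S(6)]) auto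
      show "smooth_on (S \<times> T) (\<lambda>p. (snd d' \<circ> g \<circ> inv_chart d) (snd p))"
        by (rule smooth_on_compose[OF fd(2) op T(2) _ smooth_on_bounded_linear[OF op bounded_linear_snd] T(6)]) auto
    qed
    then show "smooth_on (S \<times> T) (snd (prod_chart c' d') \<circ> map_prod f g \<circ> inv_chart (prod_chart c d))"
      by (rule smooth_on_cong[OF op, rotated]) (simp only: o_apply inv, simp)
  qed (use S T op in \<open>auto simp only: image_prod_chart, auto\<close>)
qed

lemma smooth_near_Pair_left:
  assumes "coord_chart X d" "y \<in> fst d" "a \<in> fst c"
  shows "smooth_near d (prod_chart c d) (Pair a) y"
proof (rule smooth_nearI[OF assms(2) coord_chart_open_image[OF assms(1)]])
  have "open (snd d ` fst d)" by (rule coord_chart_open_image[OF assms(1)])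
  then have "smooth_on (snd d ` fst d) (\<lambda>w. (snd c a, w))"
    by (intro smooth_on_Pair smooth_on_const smooth_on_ident)
  then show "smooth_on (snd d ` fst d) (snd (prod_chart c d) \<circ> Pair a \<circ> inv_chart d)"
    by (rule smooth_on_cong[OF coord_chart_open_image[OF assms(1)], rotated]) (simp add: f_inv_into_f)
qed (use assms in \<open>auto simp: inv_into_into\<close>)

text \<open>
  For \<open>f\<close> the multiplication of a Lie group, and a constant \<open>\<kappa>\<close>, this says that the
  differential of left translation by \<open>g\<close> depends smoothly on \<open>g\<close>.
\<close>
lemma smooth_partial_coord_deriv:
  fixes c :: "('m, 'e::real_normed_vector) chart" and d :: "('n, 'f::real_normed_vector) chart"
  assumes fd: "fin_dim (UNIV :: 'e set)" "fin_dim (UNIV :: 'f set)"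
    and inj: "inj_on (snd c) (fst c)" "inj_on (snd d) (fst d)" and d: "open (snd d ` fst d)"
    and f: "smooth_near (prod_chart c d) e f (a, b)"
    and \<kappa>: "open S" "smooth_on S \<kappa>" "snd c a \<in> S" "\<kappa> (snd c a) = snd d b"
  shows "\<exists>T. open T \<and> snd c a \<in> T \<and>
    smooth_on T (\<lambda>y. coord_deriv d e (\<lambda>w. f (inv_chart c y, w)) (inv_chart d (\<kappa> y)))"
proof -
  let ?h = "snd e \<circ> f \<circ> inv_chart (prod_chart c d)"
  obtain P where P: "open P" "(snd c a, snd d b) \<in> P" "P \<subseteq> (snd c ` fst c) \<times> (snd d ` fst d)" "smooth_on P ?h"
    using f unfolding smooth_near_def image_prod_chart by auto
  define T where "T = (\<lambda>y. (y, \<kappa> y)) -` P \<inter> S"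
  have T: "open T" unfolding T_def Int_commute[of _ S]
    by (intro continuous_open_preimage[OF _ \<kappa>(1) P(1)] continuous_intros smooth_on_continuous \<kappa>)
  have aT: "snd c a \<in> T" using \<kappa> P by (simp add: T_def)
  have \<kappa>T: "smooth_on T \<kappa>" by (rule smooth_on_subset[OF \<kappa>(2)]) (auto simp: T_def)
  have TP: "(y, \<kappa> y) \<in> P" if "y \<in> T" for y using that by (simp add: T_def)
  have part1: "smooth_on T (\<lambda>y. Blinfun (frechet_derivative (\<lambda>w. ?h (y, w)) (at (\<kappa> y))))"
    by (rule smooth_on_partial_derivative(1)[OF fd P(1,4) T \<kappa>T]) (rule TP)
  have part2: "(\<lambda>w. ?h (y, w)) differentiable at (\<kappa> y)" if "y \<in> T" for y
    by (rule smooth_on_partial_derivative(2)[OF fd P(1,4) T \<kappa>T _ that]) (rule TP)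
  have eq: "Blinfun (frechet_derivative (\<lambda>w. ?h (y, w)) (at (\<kappa> y)))
      = coord_deriv d e (\<lambda>w. f (inv_chart c y, w)) (inv_chart d (\<kappa> y))" if y: "y \<in> T" for y
  proof -
    have im: "y \<in> snd c ` fst c" "\<kappa> y \<in> snd d ` fst d" using TP[OF y] P(3) by auto
    have "frechet_derivative (\<lambda>w. ?h (y, w)) (at (\<kappa> y))
        = frechet_derivative (snd e \<circ> (\<lambda>w. f (inv_chart c y, w)) \<circ> inv_chart d) (at (\<kappa> y))"
      by (rule frechet_derivative_transform_within_open[OF part2[OF y] d im(2)])
         (simp only: o_apply inv_prod_chart[OF inj im(1)])
    then show ?thesis unfolding coord_deriv_def using im by (simp add: f_inv_into_f)
  qed
  show ?thesis
    using T aT smooth_on_cong[OF T eq part1] by blast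
qed

subsection \<open>Manifolds\<close>

lemma manifold_fin_dim: "manifold (M :: ('m, 'e::real_normed_vector) mfd) \<Longrightarrow> fin_dim (UNIV :: 'e set)"
  unfolding manifold_def fin_dim_def by auto

lemma smooth_chart_is_chart: "smooth_chart M c \<Longrightarrow> is_chart (mtop M) c"
  unfolding smooth_chart_def by blast

lemma smooth_chart_coord_chart: "smooth_chart M c \<Longrightarrow> coord_chart (mtop M) c"
  unfolding smooth_chart_def by (blast intro: is_chart_coord_chart)

lemma smooth_chart_open: "smooth_chart M c \<Longrightarrow> openin (mtop M) (fst c)"
  unfolding smooth_chart_def is_chart_def by blast

lemma atlas_smooth_chart: "manifold M \<Longrightarrow> c \<in> atlas M \<Longrightarrow> smooth_chart M c"
  unfolding manifold_def smooth_chart_def by blast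

lemma atlas_cover: "manifold M \<Longrightarrow> x \<in> topspace (mtop M) \<Longrightarrow> \<exists>c\<in>atlas M. x \<in> fst c"
  unfolding manifold_def by blast

text \<open>
  Members of the maximal atlas are by definition compatible only with the charts of the atlas;
  the two are compared through such a chart.
\<close>
lemma smooth_chart_smooth_near_id:
  fixes M :: "('m, 'e::real_normed_vector) mfd"
  assumes M: "manifold M" and c: "smooth_chart M c" and d: "smooth_chart M d" and "x \<in> fst c" "x \<in> fst d"
  shows "smooth_near c d id x"
proof -
  have "x \<in> topspace (mtop M)" using smooth_chart_open[OF c] assms(4) openin_subset by blast
  then obtain a where a: "a \<in> atlas M" "x \<in> fst a" using atlas_cover[OF M] by blast
  note a' = atlas_smooth_chart[OF M a(1)]
  have "smooth_near c a id x"
    using c a(1) assms(4) a(2) smooth_chart_open[OF a'] smooth_chart_coord_chart[OF c]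
    by (auto simp: smooth_chart_def intro: compatible_smooth_near)
  moreover have "smooth_near a d id (id x)"
    using d a(1) assms(5) a(2) smooth_chart_open[OF d] smooth_chart_coord_chart[OF a']
    by (auto simp: smooth_chart_def compatible_sym[of d] intro: compatible_smooth_near)
  ultimately have "smooth_near c d (id \<circ> id) x"
    by (rule smooth_near_compose(1)[OF manifold_fin_dim[OF M]
          coord_chart_inj[OF smooth_chart_coord_chart[OF c]] coord_chart_inj[OF smooth_chart_coord_chart[OF a']]])
  then show ?thesis by simp
qed

lemma smooth_map_smooth_near_smooth_chart:
  fixes M :: "('m, 'e::real_normed_vector) mfd" and N :: "('n, 'f::real_normed_vector) mfd"
  assumes M: "manifold M" and N: "manifold N" and f: "smooth_map M N f"
    and c: "smooth_chart M c" and d: "smooth_chart N d" and x: "x \<in> fst c" "f x \<in> fst d"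
  shows "smooth_near c d f x"
proof -
  have "x \<in> topspace (mtop M)" using smooth_chart_open[OF c] x openin_subset by blast
  then obtain a where a: "a \<in> atlas M" "x \<in> fst a" using atlas_cover[OF M] by blast
  have "f x \<in> topspace (mtop N)" using smooth_chart_open[OF d] x openin_subset by blast
  then obtain b where b: "b \<in> atlas N" "f x \<in> fst b" using atlas_cover[OF N] by blast
  note a' = atlas_smooth_chart[OF M a(1)] and b' = atlas_smooth_chart[OF N b(1)]
  note i = coord_chart_inj[OF smooth_chart_coord_chart]
  have 1: "smooth_near c a id x" by (rule smooth_chart_smooth_near_id[OF M c a' x(1) a(2)])
  have 2: "smooth_near a b f (id x)"
    using smooth_map_smooth_near[OF f a(1) b(1) smooth_chart_coord_chart[OF a'] smooth_chart_open[OF b']] a b by simp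
  have 3: "smooth_near b d id (f x)" by (rule smooth_chart_smooth_near_id[OF N b' d b(2) x(2)])
  have "smooth_near c b (f \<circ> id) x"
    by (rule smooth_near_compose(1)[OF manifold_fin_dim[OF M] i[OF c] i[OF a'] 1 2])
  then have "smooth_near c b f x" by simp
  from smooth_near_compose(1)[OF manifold_fin_dim[OF N] i[OF c] i[OF b'] this 3]
  show ?thesis by (simp only: id_comp)
qed

text \<open>
  Charts of a quotient come from charts of the group with small domains, and those arise by
  restriction.
\<close>
lemma smooth_chart_restrict:
  assumes M: "manifold M" and c: "smooth_chart M c" and W: "openin (mtop M) W"
  shows "smooth_chart M (fst c \<inter> W, snd c)"
proof -
  let ?c = "(fst c \<inter> W, snd c)"
  have ic: "is_chart (mtop M) c" and comp: "\<And>d. d \<in> atlas M \<Longrightarrow> compatible c d"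
    using c unfolding smooth_chart_def by auto
  have cc: "coord_chart (mtop M) c" by (rule is_chart_coord_chart[OF ic])
  have inj: "inj_on (snd c) (fst c)" by (rule coord_chart_inj[OF cc])
  have op: "open (snd c ` (fst c \<inter> V))" if "openin (mtop M) V" for V
    using cc that unfolding coord_chart_def by blast
  have o: "openin (mtop M) (fst c)" using ic unfolding is_chart_def by blast
  have "is_chart (mtop M) ?c"
    unfolding is_chart_def fst_conv snd_conv
  proof (intro conjI)
    show "openin (mtop M) (fst c \<inter> W)" using o W by (rule openin_Int)
    show "open (snd c ` (fst c \<inter> W))" by (rule op[OF W])
    have h: "homeomorphic_map (subtopology (mtop M) (fst c)) (top_of_set (snd c ` fst c)) (snd c)"
      using ic unfolding is_chart_def by blast
    have "homeomorphic_map (subtopology (subtopology (mtop M) (fst c)) (fst c \<inter> W))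
        (subtopology (top_of_set (snd c ` fst c)) (snd c ` (fst c \<inter> W))) (snd c)"
      by (rule homeomorphic_map_subtopologies[OF h]) (use openin_subset[OF o] in auto)
    moreover have "fst c \<inter> (fst c \<inter> W) = fst c \<inter> W" "snd c ` fst c \<inter> snd c ` (fst c \<inter> W) = snd c ` (fst c \<inter> W)"
      by auto
    ultimately show "homeomorphic_map (subtopology (mtop M) (fst c \<inter> W)) (top_of_set (snd c ` (fst c \<inter> W))) (snd c)"
      by (simp add: subtopology_subtopology)
  qed
  moreover have "compatible ?c d" if d: "d \<in> atlas M" for d
    unfolding compatible_def
  proof
    have *: "smooth_on (snd c ` (fst c \<inter> fst d)) (transition c d)"
      "smooth_on (snd d ` (fst c \<inter> fst d)) (transition d c)"
      using comp[OF d] unfolding compatible_def by auto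
    have inv: "inv_into (fst c \<inter> W) (snd c) y = inv_chart c y" if "y \<in> snd c ` (fst c \<inter> W \<inter> fst d)" for y
      using that inj inj_on_subset[OF inj, of "fst c \<inter> W"] by (auto simp: inv_into_f_f)
    have "fst c \<inter> W \<inter> fst d = fst c \<inter> (W \<inter> fst d)" by auto
    then have op1: "open (snd c ` (fst c \<inter> W \<inter> fst d))"
      using op[OF openin_Int[OF W smooth_chart_open[OF atlas_smooth_chart[OF M d]]]] by simp
    have "smooth_on (snd c ` (fst c \<inter> W \<inter> fst d)) (transition c d)"
      by (rule smooth_on_subset[OF *(1)]) auto
    then show "smooth_on (snd ?c ` (fst ?c \<inter> fst d)) (transition ?c d)"
      unfolding fst_conv snd_conv
      by (rule smooth_on_cong[OF op1, rotated]) (simp add: transition_def inv)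
    have "smooth_on (snd d ` (fst c \<inter> W \<inter> fst d)) (transition d c)"
      by (rule smooth_on_subset[OF *(2)]) auto
    then show "smooth_on (snd d ` (fst ?c \<inter> fst d)) (transition d ?c)"
      by (simp add: transition_def)
  qed
  ultimately show ?thesis
    unfolding smooth_chart_def by blast
qed

section \<open>Lie groups and their quotients\<close>

locale lie_quotient =
  fixes G :: "('g, 'r) monoid_scheme" (structure)
    and M :: "('g, 'e::real_normed_vector) mfd"
    and \<Gamma> :: "'g set"
  assumes lie: "lie_group G M" and subgroup: "subgroup \<Gamma> G"
    and discrete: "subtopology (mtop M) \<Gamma> = discrete_topology \<Gamma>"
begin

sublocale group G
  using lie unfolding lie_group_def by blast

abbreviation proj :: "'g \<Rightarrow> 'g set" where
  "proj \<equiv> (#>) \<Gamma>"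

abbreviation quot :: "('g set, 'e) mfd" where
  "quot \<equiv> quotient_mfd G M \<Gamma>"

lemma mfd: "manifold M"
  and topspace_M: "topspace (mtop M) = carrier G"
  and smooth_mult: "smooth_map (prod_mfd M M) M (\<lambda>(g, h). g \<otimes> h)"
  and smooth_inv: "smooth_map M M (\<lambda>g. inv g)"
  using lie unfolding lie_group_def by auto

lemma fd: "fin_dim (UNIV :: 'e set)"
  by (rule manifold_fin_dim[OF mfd])

lemma smooth_chart_inj: "smooth_chart M c \<Longrightarrow> inj_on (snd c) (fst c)"
  by (rule coord_chart_inj[OF smooth_chart_coord_chart])

lemma smooth_chart_subset: "smooth_chart M c \<Longrightarrow> fst c \<subseteq> carrier G"
  using smooth_chart_open[of M c] openin_subset topspace_M by metis

lemma chart_at_M: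
  assumes "g \<in> carrier G"
  shows "smooth_chart M (chart_at M g)" "g \<in> fst (chart_at M g)"
proof -
  have "\<exists>c. c \<in> atlas M \<and> g \<in> fst c"
    using atlas_cover[OF mfd] assms topspace_M by blast
  from someI_ex[OF this] show "smooth_chart M (chart_at M g)" "g \<in> fst (chart_at M g)"
    unfolding chart_at_def[symmetric] using atlas_smooth_chart[OF mfd] by auto
qed

lemma smooth_near_mult:
  assumes c: "smooth_chart M c" and d: "smooth_chart M d" and e: "smooth_chart M e"
    and x: "g \<in> fst c" "h \<in> fst d" "g \<otimes> h \<in> fst e"
  shows "smooth_near (prod_chart c d) e (\<lambda>(g, h). g \<otimes> h) (g, h)"
proof -
  have gh: "g \<in> carrier G" "h \<in> carrier G" "g \<otimes> h \<in> carrier G"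
    using smooth_chart_subset c d e x by blast+
  obtain a where a: "a \<in> atlas M" "g \<in> fst a" using atlas_cover[OF mfd] gh topspace_M by blast
  obtain b where b: "b \<in> atlas M" "h \<in> fst b" using atlas_cover[OF mfd] gh topspace_M by blast
  obtain q where q: "q \<in> atlas M" "g \<otimes> h \<in> fst q" using atlas_cover[OF mfd] gh topspace_M by blast
  note a' = atlas_smooth_chart[OF mfd a(1)] and b' = atlas_smooth_chart[OF mfd b(1)]
    and q' = atlas_smooth_chart[OF mfd q(1)]
  note i = smooth_chart_inj
  have 1: "smooth_near (prod_chart c d) (prod_chart a b) (map_prod id id) (g, h)"
    by (rule smooth_near_map_prod[OF fd fd i[OF c] i[OF d]
          smooth_chart_smooth_near_id[OF mfd c a' x(1) a(2)]
          smooth_chart_smooth_near_id[OF mfd d b' x(2) b(2)]])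
  have 2: "smooth_near (prod_chart a b) q (\<lambda>(g, h). g \<otimes> h) (map_prod id id (g, h))"
  proof (rule smooth_map_smooth_near[OF smooth_mult _ q(1) _ smooth_chart_open[OF q']])
    show "prod_chart a b \<in> atlas (prod_mfd M M)"
      using a(1) b(1) unfolding prod_mfd_def prod_chart_def mfd.select_convs by blast
    show "coord_chart (mtop (prod_mfd M M)) (prod_chart a b)"
      unfolding prod_mfd_def using coord_chart_prod[OF smooth_chart_coord_chart[OF a'] smooth_chart_coord_chart[OF b']]
      by simp
  qed (use a b q in auto)
  have 3: "smooth_near q e id (((\<lambda>(g, h). g \<otimes> h) \<circ> map_prod id id) (g, h))"
    using smooth_chart_smooth_near_id[OF mfd q' e q(2) x(3)] by simp
  have 4: "smooth_near (prod_chart c d) q ((\<lambda>(g, h). g \<otimes> h) \<circ> map_prod id id) (g, h)"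
    by (rule smooth_near_compose(1)[OF fin_dim_Times[OF fd fd] inj_prod_chart[OF i[OF c] i[OF d]]
          inj_prod_chart[OF i[OF a'] i[OF b']] 1 2])
  from smooth_near_compose(1)[OF fd inj_prod_chart[OF i[OF c] i[OF d]] i[OF q'] 4 3]
  show ?thesis by (simp only: map_prod.id id_comp comp_id)
qed

text \<open>
  The inverse of the differential of \<open>h \<mapsto> gh\<close> is the differential of \<open>h \<mapsto> g\<inverse>h\<close>. Its smoothness
  in \<open>g\<close> is read off from this map, which spares the smoothness of operator inversion.
\<close>
lemma smooth_near_left_divide:
  assumes c: "smooth_chart M c" and d: "smooth_chart M d" and e: "smooth_chart M e"
    and x: "g \<in> fst c" "h \<in> fst d" "inv g \<otimes> h \<in> fst e"
  shows "smooth_near (prod_chart c d) e (\<lambda>(g, h). inv g \<otimes> h) (g, h)"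
proof -
  have g: "g \<in> carrier G" "inv g \<in> carrier G" using smooth_chart_subset[OF c] x by auto
  let ?a = "chart_at M (inv g)"
  note a = chart_at_M[OF g(2)]
  note i = smooth_chart_inj
  have 1: "smooth_near (prod_chart c d) (prod_chart ?a d) (map_prod (\<lambda>g. inv g) id) (g, h)"
    by (rule smooth_near_map_prod[OF fd fd i[OF c] i[OF d]
          smooth_map_smooth_near_smooth_chart[OF mfd mfd smooth_inv c a(1) x(1) a(2)]
          smooth_chart_smooth_near_id[OF mfd d d x(2) x(2)]])
  have 2: "smooth_near (prod_chart ?a d) e (\<lambda>(g, h). g \<otimes> h) (map_prod (\<lambda>g. inv g) id (g, h))"
    using smooth_near_mult[OF a(1) d e a(2) x(2,3)] by simp
  have eq: "(\<lambda>(g, h). g \<otimes> h) \<circ> map_prod (\<lambda>g. inv g) id = (\<lambda>(g, h). inv g \<otimes> h)" by auto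
  from smooth_near_compose(1)[OF fin_dim_Times[OF fd fd] inj_prod_chart[OF i[OF c] i[OF d]]
          inj_prod_chart[OF i[OF a(1)] i[OF d]] 1 2]
  show ?thesis unfolding eq .
qed

lemma smooth_near_left_translation:
  assumes c: "smooth_chart M c" and d: "smooth_chart M d"
    and x: "g \<in> carrier G" "h \<in> fst c" "g \<otimes> h \<in> fst d"
  shows "smooth_near c d (\<lambda>h. g \<otimes> h) h"
proof -
  note a = chart_at_M[OF x(1)]
  note i = smooth_chart_inj
  have eq: "(\<lambda>(g, h). g \<otimes> h) \<circ> Pair g = (\<lambda>h. g \<otimes> h)" by auto
  from smooth_near_compose(1)[OF fin_dim_Times[OF fd fd] i[OF c] inj_prod_chart[OF i[OF a(1)] i[OF c]]
      smooth_near_Pair_left[OF smooth_chart_coord_chart[OF c] x(2) a(2)]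
      smooth_near_mult[OF a(1) c d a(2) x(2,3)]]
  show ?thesis unfolding eq .
qed

lemma continuous_mult:
  "continuous_map (prod_topology (mtop M) (mtop M)) (mtop M) (\<lambda>(g, h). g \<otimes> h)"
  using smooth_mult unfolding smooth_map_def prod_mfd_def by simp

lemma continuous_translations:
  assumes g: "g \<in> carrier G"
  shows "continuous_map (mtop M) (mtop M) (\<lambda>h. g \<otimes> h)"
    and "continuous_map (mtop M) (mtop M) (\<lambda>h. h \<otimes> g)"
proof -
  have 1: "continuous_map (mtop M) (prod_topology (mtop M) (mtop M)) (\<lambda>h. (g, h))"
    "continuous_map (mtop M) (prod_topology (mtop M) (mtop M)) (\<lambda>h. (h, g))"
    using g by (auto simp: continuous_map_pairwise o_def topspace_M)
  show "continuous_map (mtop M) (mtop M) (\<lambda>h. g \<otimes> h)" "continuous_map (mtop M) (mtop M) (\<lambda>h. h \<otimes> g)"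
    using continuous_map_compose[OF 1(1) continuous_mult] continuous_map_compose[OF 1(2) continuous_mult]
    by (simp_all add: o_def)
qed

subsection \<open>The quotient as a topological space\<close>

lemma \<Gamma>_carrier: "\<gamma> \<in> \<Gamma> \<Longrightarrow> \<gamma> \<in> carrier G"
  using subgroup by (rule subgroup.mem_carrier)

lemma proj_translate: "\<gamma> \<in> \<Gamma> \<Longrightarrow> g \<in> carrier G \<Longrightarrow> proj (\<gamma> \<otimes> g) = proj g"
  using coset_mult_assoc[of \<Gamma> \<gamma> g] coset_join2[OF \<Gamma>_carrier subgroup] subgroup.subset[OF subgroup] \<Gamma>_carrier
  by simp

lemma proj_eqD:
  assumes "g \<in> carrier G" "h \<in> carrier G" "proj g = proj h"
  obtains \<gamma> where "\<gamma> \<in> \<Gamma>" "h = \<gamma> \<otimes> g"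
proof -
  have "h \<in> proj h" using subgroup.one_closed[OF subgroup] assms unfolding r_coset_def by force
  then show ?thesis using that assms unfolding r_coset_def by blast
qed

lemma proj_in_rcosets: "g \<in> carrier G \<Longrightarrow> proj g \<in> rcosets \<Gamma>"
  unfolding RCOSETS_def by blast

lemma rcosetsE:
  assumes "x \<in> rcosets \<Gamma>" obtains g where "g \<in> carrier G" "x = proj g"
  using assms unfolding RCOSETS_def by blast

lemma openin_quot: "openin (mtop quot) V \<longleftrightarrow> V \<subseteq> rcosets \<Gamma> \<and> openin (mtop M) {g \<in> carrier G. proj g \<in> V}"
  by (simp add: quotient_mfd_def openin_quotient_top topspace_M)

lemma topspace_quot: "topspace (mtop quot) = rcosets \<Gamma>"
proof -
  have "{g \<in> carrier G. proj g \<in> rcosets \<Gamma>} = carrier G" using proj_in_rcosets by auto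
  then have "openin (mtop quot) (rcosets \<Gamma>)"
    using openin_topspace[of "mtop M"] by (simp add: openin_quot topspace_M)
  then show ?thesis by (metis openin_quot openin_subset openin_topspace subset_antisym)
qed

text \<open>
  The preimage of \<open>proj ` V\<close> is the union of the translates of \<open>V\<close> by \<open>\<Gamma>\<close>.
\<close>
lemma open_proj:
  assumes V: "openin (mtop M) V"
  shows "openin (mtop quot) (proj ` V)"
proof -
  have sub: "V \<subseteq> carrier G" using openin_subset[OF V] topspace_M by simp
  have "{g \<in> carrier G. proj g \<in> proj ` V} = (\<Union>\<gamma>\<in>\<Gamma>. {g \<in> topspace (mtop M). \<gamma> \<otimes> g \<in> V})" (is "?L = ?R")
  proof
    show "?L \<subseteq> ?R"
    proof
      fix g assume "g \<in> ?L"
      then obtain v where v: "g \<in> carrier G" "v \<in> V" "proj g = proj v" by auto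
      then obtain \<gamma> where "\<gamma> \<in> \<Gamma>" "v = \<gamma> \<otimes> g" using proj_eqD sub by blast
      then show "g \<in> ?R" using v topspace_M by auto
    qed
    show "?R \<subseteq> ?L" using proj_translate topspace_M by (auto simp: image_iff)
  qed
  moreover have "openin (mtop M) ?R"
    using \<Gamma>_carrier by (intro openin_Union) (auto intro!: openin_continuous_map_preimage[OF continuous_translations(1)] V)
  ultimately show ?thesis
    using sub proj_in_rcosets by (auto simp: openin_quot)
qed

lemma continuous_right_translation:
  assumes h: "h \<in> carrier G"
  shows "continuous_map (mtop quot) (mtop quot) (\<lambda>x. x #> h)"
  unfolding continuous_map
proof (intro conjI allI impI)
  have *: "proj g #> h = proj (g \<otimes> h)" if "g \<in> carrier G" for g
    using coset_mult_assoc[OF subgroup.subset[OF subgroup] that h] .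
  show "(\<lambda>x. x #> h) ` topspace (mtop quot) \<subseteq> topspace (mtop quot)"
    using h * by (auto simp: topspace_quot elim!: rcosetsE intro!: proj_in_rcosets)
  fix V assume V: "openin (mtop quot) V"
  have "{g \<in> carrier G. proj g \<in> {x \<in> topspace (mtop quot). x #> h \<in> V}}
      = {g \<in> topspace (mtop M). g \<otimes> h \<in> {g \<in> carrier G. proj g \<in> V}}"
    using * h by (auto simp: topspace_quot topspace_M proj_in_rcosets)
  moreover have "openin (mtop M) \<dots>"
    using V by (intro openin_continuous_map_preimage[OF continuous_translations(2)[OF h]]) (simp add: openin_quot)
  ultimately show "openin (mtop quot) {x \<in> topspace (mtop quot). x #> h \<in> V}"
    by (simp add: openin_quot topspace_quot)
qed

subsection \<open>Charts of the quotient\<close>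

definition lift_chart :: "('g, 'e) chart \<Rightarrow> bool" where
  "lift_chart c \<longleftrightarrow> smooth_chart M c \<and> inj_on proj (fst c)"

definition push_chart :: "('g, 'e) chart \<Rightarrow> ('g set, 'e) chart" where
  "push_chart c = (proj ` fst c, snd c \<circ> inv_into (fst c) proj)"

lemma fst_push_chart: "fst (push_chart c) = proj ` fst c"
  by (simp add: push_chart_def)

lemma snd_push_chart: "lift_chart c \<Longrightarrow> g \<in> fst c \<Longrightarrow> snd (push_chart c) (proj g) = snd c g"
  by (simp add: push_chart_def lift_chart_def)

lemma atlas_quot: "atlas quot = {push_chart c | c. lift_chart c}"
  unfolding quotient_mfd_def push_chart_def lift_chart_def by force

lemma push_chart_in_atlas: "lift_chart c \<Longrightarrow> push_chart c \<in> atlas quot"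
  unfolding atlas_quot by blast

lemma image_push_chart: "lift_chart c \<Longrightarrow> snd (push_chart c) ` fst (push_chart c) = snd c ` fst c"
  by (simp add: fst_push_chart image_image snd_push_chart cong: image_cong)

lemma inj_push_chart:
  assumes "lift_chart c"
  shows "inj_on (snd (push_chart c)) (fst (push_chart c))"
proof (rule inj_onI)
  fix x y assume xy: "x \<in> fst (push_chart c)" "y \<in> fst (push_chart c)"
    and eq: "snd (push_chart c) x = snd (push_chart c) y"
  obtain u v where u: "u \<in> fst c" "x = proj u" and v: "v \<in> fst c" "y = proj v"
    using xy by (auto simp: fst_push_chart)
  have "snd c u = snd c v" using eq snd_push_chart[OF assms] u v by simp
  then have "u = v" using smooth_chart_inj[of c] assms u v by (auto simp: lift_chart_def dest: inj_onD)
  then show "x = y" using u v by simp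
qed

lemma inv_push_chart:
  assumes "lift_chart c" "y \<in> snd c ` fst c"
  shows "inv_chart (push_chart c) y = proj (inv_chart c y)"
  using assms by (intro inv_into_f_eq inj_push_chart)
    (auto simp: fst_push_chart snd_push_chart inv_into_into f_inv_into_f)

lemma coord_chart_push_chart:
  assumes c: "lift_chart c"
  shows "coord_chart (mtop quot) (push_chart c)"
  unfolding coord_chart_def
proof (intro conjI allI impI)
  have sc: "smooth_chart M c" using c unfolding lift_chart_def by blast
  show "fst (push_chart c) \<subseteq> topspace (mtop quot)"
    using smooth_chart_subset[OF sc] by (auto simp: fst_push_chart topspace_quot proj_in_rcosets)
  show "inj_on (snd (push_chart c)) (fst (push_chart c))" by (rule inj_push_chart[OF c])
  fix W assume W: "openin (mtop quot) W"
  have "fst (push_chart c) \<inter> W = proj ` (fst c \<inter> {g \<in> carrier G. proj g \<in> W})"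
    using smooth_chart_subset[OF sc] by (auto simp: fst_push_chart)
  then have "snd (push_chart c) ` (fst (push_chart c) \<inter> W)
      = (\<lambda>g. snd (push_chart c) (proj g)) ` (fst c \<inter> {g \<in> carrier G. proj g \<in> W})"
    by (simp only: image_image)
  also have "\<dots> = snd c ` (fst c \<inter> {g \<in> carrier G. proj g \<in> W})"
    by (rule image_cong[OF refl]) (simp add: snd_push_chart[OF c])
  finally have "snd (push_chart c) ` (fst (push_chart c) \<inter> W) = snd c ` (fst c \<inter> {g \<in> carrier G. proj g \<in> W})" .
  moreover have "open (snd c ` (fst c \<inter> {g \<in> carrier G. proj g \<in> W}))"
    using W smooth_chart_coord_chart[OF sc] unfolding coord_chart_def openin_quot by blast
  ultimately show "open (snd (push_chart c) ` (fst (push_chart c) \<inter> W))" by (rule ssubst)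
qed

lemma open_push_chart: "lift_chart c \<Longrightarrow> openin (mtop quot) (fst (push_chart c))"
  by (simp add: fst_push_chart lift_chart_def open_proj smooth_chart_open)

text \<open>
  The quotient \<open>uv\<inverse>\<close> of two points near \<open>g\<close> is close to the identity, and \<open>\<Gamma>\<close> has no other element
  there. So two points near \<open>g\<close> in the same coset are equal.
\<close>
lemma lift_chart_exists:
  assumes g: "g \<in> carrier G"
  obtains c where "lift_chart c" "g \<in> fst c"
proof -
  have one: "\<one> \<in> \<Gamma>" using subgroup by (rule subgroup.one_closed)
  have "openin (subtopology (mtop M) \<Gamma>) {\<one>}" using one by (simp add: discrete)
  then obtain V where V: "openin (mtop M) V" "V \<inter> \<Gamma> = {\<one>}" by (auto simp: openin_subtopology)
  define \<delta> where "\<delta> = (\<lambda>(g, h). g \<otimes> h) \<circ> map_prod id (\<lambda>g. inv g)"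
  have "continuous_map (mtop M) (mtop M) (\<lambda>g. inv g)" using smooth_inv unfolding smooth_map_def by blast
  then have "continuous_map (prod_topology (mtop M) (mtop M)) (mtop M) \<delta>"
    unfolding \<delta>_def map_prod_def
    by (intro continuous_map_compose[OF _ continuous_mult])
       (auto simp: continuous_map_pairwise o_def case_prod_beta
          intro!: continuous_map_fst continuous_map_snd continuous_map_compose[OF continuous_map_snd, unfolded o_def])
  then have "openin (prod_topology (mtop M) (mtop M)) {p \<in> topspace (prod_topology (mtop M) (mtop M)). \<delta> p \<in> V}"
    using V(1) by (rule openin_continuous_map_preimage)
  moreover have "(g, g) \<in> {p \<in> topspace (prod_topology (mtop M) (mtop M)). \<delta> p \<in> V}"
    using g V(2) by (auto simp: topspace_M \<delta>_def)
  ultimately obtain A B where AB: "openin (mtop M) A" "openin (mtop M) B" "g \<in> A" "g \<in> B"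
      and sub: "A \<times> B \<subseteq> {p \<in> topspace (prod_topology (mtop M) (mtop M)). \<delta> p \<in> V}"
    unfolding openin_prod_topology_alt by meson
  have AB_V: "u \<otimes> inv v \<in> V" if "u \<in> A" "v \<in> B" for u v
  proof -
    have "(u, v) \<in> A \<times> B" using that by simp
    from subsetD[OF sub this] show ?thesis by (simp add: \<delta>_def)
  qed
  note a = chart_at_M[OF g]
  let ?c = "(fst (chart_at M g) \<inter> (A \<inter> B), snd (chart_at M g))"
  have sc: "smooth_chart M ?c" by (rule smooth_chart_restrict[OF mfd a(1) openin_Int[OF AB(1,2)]])
  have "inj_on proj (fst ?c)"
  proof (rule inj_onI)
    fix u v assume uv: "u \<in> fst ?c" "v \<in> fst ?c" "proj u = proj v"
    then have car: "u \<in> carrier G" "v \<in> carrier G" using smooth_chart_subset[OF sc] by auto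
    from proj_eqD[OF car(2,1)] uv(3) obtain \<gamma> where \<gamma>: "\<gamma> \<in> \<Gamma>" "u = \<gamma> \<otimes> v" by metis
    have "u \<otimes> inv v = \<gamma>" using \<gamma> car \<Gamma>_carrier[of \<gamma>] by (simp add: m_assoc)
    then have "\<gamma> = \<one>" using AB_V[of u v] uv \<gamma>(1) V(2) by auto
    then show "u = v" using \<gamma> car by simp
  qed
  then show ?thesis using sc a(2) AB by (intro that[of ?c]) (auto simp: lift_chart_def)
qed

lemma chart_at_quot:
  assumes "x \<in> rcosets \<Gamma>"
  obtains c where "lift_chart c" "chart_at quot x = push_chart c" "x \<in> fst (push_chart c)"
proof -
  obtain g where g: "g \<in> carrier G" "x = proj g" using assms by (rule rcosetsE)
  obtain c where "lift_chart c" "g \<in> fst c" using lift_chart_exists[OF g(1)] .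
  then have "\<exists>c. c \<in> atlas quot \<and> x \<in> fst c"
    using push_chart_in_atlas g(2) fst_push_chart by blast
  from someI_ex[OF this] have "chart_at quot x \<in> atlas quot" "x \<in> fst (chart_at quot x)"
    unfolding chart_at_def[symmetric] by auto
  then show ?thesis using that unfolding atlas_quot by auto
qed

text \<open>
  In the charts \<open>c\<close> and \<open>push_chart c\<close> the projection is the identity.
\<close>
lemma smooth_near_proj_push:
  assumes c: "lift_chart c" and g: "g \<in> fst c"
  shows "smooth_near c (push_chart c) proj g" "coord_deriv c (push_chart c) proj g = id_blinfun"
proof -
  have cc: "coord_chart (mtop M) c" using c smooth_chart_coord_chart unfolding lift_chart_def by blast
  note op = coord_chart_open_image[OF cc]
  have eq: "y = (snd (push_chart c) \<circ> proj \<circ> inv_chart c) y" if "y \<in> snd c ` fst c" for y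
    using that c by (simp add: f_inv_into_f snd_push_chart inv_into_into)
  show "smooth_near c (push_chart c) proj g"
  proof (rule smooth_nearI[OF g op])
    show "smooth_on (snd c ` fst c) (snd (push_chart c) \<circ> proj \<circ> inv_chart c)"
      by (rule smooth_on_cong[OF op eq smooth_on_ident[OF op]])
  qed (use g in \<open>auto simp: inv_into_into fst_push_chart\<close>)
  have "((\<lambda>y. y) has_derivative (\<lambda>v. v)) (at (snd c g))" by (rule has_derivative_ident)
  then have "(snd (push_chart c) \<circ> proj \<circ> inv_chart c has_derivative (\<lambda>v. v)) (at (snd c g))"
    by (rule has_derivative_transform_within_open[OF _ op]) (use eq g in auto)
  from coord_derivI[OF this] show "coord_deriv c (push_chart c) proj g = id_blinfun"
    by (simp add: id_blinfun_def)
qed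

lemma smooth_near_section:
  assumes c: "lift_chart c" and x: "x \<in> fst (push_chart c)"
  shows "smooth_near (push_chart c) c (inv_into (fst c) proj) x"
proof -
  note op = coord_chart_open_image[OF coord_chart_push_chart[OF c]]
  have inj: "inj_on proj (fst c)" using c unfolding lift_chart_def by blast
  have eq: "y = (snd c \<circ> inv_into (fst c) proj \<circ> inv_chart (push_chart c)) y"
    if "y \<in> snd (push_chart c) ` fst (push_chart c)" for y
    using that c inj by (simp add: image_push_chart inv_push_chart inv_into_into f_inv_into_f)
  show ?thesis
  proof (rule smooth_nearI[OF x op])
    show "smooth_on (snd (push_chart c) ` fst (push_chart c))
        (snd c \<circ> inv_into (fst c) proj \<circ> inv_chart (push_chart c))"
      by (rule smooth_on_cong[OF op eq smooth_on_ident[OF op]])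
    show "inv_into (fst c) proj (inv_chart (push_chart c) y) \<in> fst c"
      if "y \<in> snd (push_chart c) ` fst (push_chart c)" for y
      using that c by (auto simp: image_push_chart inv_push_chart intro!: inv_into_into)
  qed (use x in auto)
qed

text \<open>
  The domain of \<open>c\<close> need not contain \<open>g\<close> but only some \<open>\<gamma>g\<close> with \<open>\<gamma> \<in> \<Gamma>\<close>; the projection is
  unchanged by a translation by \<open>\<gamma>\<close>.
\<close>
lemma smooth_near_proj:
  assumes d: "smooth_chart M d" and c: "lift_chart c" and g: "g \<in> fst d" "proj g \<in> fst (push_chart c)"
  shows "smooth_near d (push_chart c) proj g"
proof -
  have c': "smooth_chart M c" using c unfolding lift_chart_def by blast
  obtain v where v: "v \<in> fst c" "proj g = proj v" using g(2) by (auto simp: fst_push_chart)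
  have car: "g \<in> carrier G" "v \<in> carrier G" using smooth_chart_subset d c' g v by blast+
  then obtain \<gamma> where \<gamma>: "\<gamma> \<in> \<Gamma>" "v = \<gamma> \<otimes> g" using proj_eqD v(2) by metis
  have 1: "smooth_near d c (\<lambda>h. \<gamma> \<otimes> h) g"
    using smooth_near_left_translation[OF d c' \<Gamma>_carrier[OF \<gamma>(1)] g(1)] v \<gamma> by simp
  have 2: "smooth_near c (push_chart c) proj (\<gamma> \<otimes> g)"
    using smooth_near_proj_push(1)[OF c] v \<gamma> by simp
  show ?thesis
    using smooth_near_compose(1)[OF fd smooth_chart_inj[OF d] smooth_chart_inj[OF c'] 1 2]
    by (rule smooth_near_cong(1)) (use proj_translate[OF \<gamma>(1)] smooth_chart_subset[OF d] in auto)
qed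

text \<open>
  Two charts of the quotient are compared through the group: near \<open>x\<close> the identity is the section
  over the first chart followed by the projection.
\<close>
lemma smooth_near_quot_id:
  assumes c: "lift_chart c" and d: "lift_chart d" and x: "x \<in> fst (push_chart c)" "x \<in> fst (push_chart d)"
  shows "smooth_near (push_chart c) (push_chart d) id x"
proof -
  have c': "smooth_chart M c" using c unfolding lift_chart_def by blast
  have s: "inv_into (fst c) proj z \<in> fst c" "proj (inv_into (fst c) proj z) = z" if "z \<in> fst (push_chart c)" for z
    using that by (auto simp: fst_push_chart inv_into_into f_inv_into_f)
  have 2: "smooth_near c (push_chart d) proj (inv_into (fst c) proj x)"
    by (rule smooth_near_proj[OF c' d]) (use s[OF x(1)] x(2) in auto)
  show ?thesis
    using smooth_near_compose(1)[OF fd inj_push_chart[OF c] smooth_chart_inj[OF c'] smooth_near_section[OF c x(1)] 2]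
    by (rule smooth_near_cong(1)) (use s in auto)
qed

end

lemma blinfun_compose_assoc: "(f o\<^sub>L g) o\<^sub>L h = f o\<^sub>L (g o\<^sub>L h)"
  by (rule blinfun_eqI) simp

lemma blinfun_compose_id [simp]: "id_blinfun o\<^sub>L f = f" "f o\<^sub>L id_blinfun = f"
  by (rule blinfun_eqI, simp)+

context lie_quotient
begin

section \<open>The trivialization of the tangent bundle\<close>

abbreviation base_chart :: "('g, 'e) chart" where
  "base_chart \<equiv> chart_at M \<one>"

abbreviation field :: "'g \<Rightarrow> ('e \<Rightarrow>\<^sub>L 'e)" where
  "field \<equiv> quotient_field G M \<Gamma>"

lemma base_chart: "smooth_chart M base_chart" "\<one> \<in> fst base_chart"
  by (rule chart_at_M[OF one_closed])+

lemma orbit_deriv: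
  assumes c: "lift_chart c" and d: "smooth_chart M d" and g: "g \<in> fst d" "proj g \<in> fst (push_chart c)"
  shows "smooth_near base_chart (push_chart c) (\<lambda>h. proj (g \<otimes> h)) \<one>"
    and "coord_deriv base_chart (push_chart c) (\<lambda>h. proj (g \<otimes> h)) \<one>
      = coord_deriv d (push_chart c) proj g o\<^sub>L coord_deriv base_chart d (\<lambda>h. g \<otimes> h) \<one>"
proof -
  have gc: "g \<in> carrier G" using g smooth_chart_subset[OF d] by auto
  have 1: "smooth_near base_chart d (\<lambda>h. g \<otimes> h) \<one>"
    using smooth_near_left_translation[OF base_chart(1) d gc base_chart(2)] gc g by simp
  have 2: "smooth_near d (push_chart c) proj (g \<otimes> \<one>)"
    using smooth_near_proj[OF d c g] gc by simp
  note * = smooth_near_compose[OF fd smooth_chart_inj[OF base_chart(1)] smooth_chart_inj[OF d] 1 2]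
  show "smooth_near base_chart (push_chart c) (\<lambda>h. proj (g \<otimes> h)) \<one>"
    using *(1) by (simp add: o_def)
  show "coord_deriv base_chart (push_chart c) (\<lambda>h. proj (g \<otimes> h)) \<one>
      = coord_deriv d (push_chart c) proj g o\<^sub>L coord_deriv base_chart d (\<lambda>h. g \<otimes> h) \<one>"
    using *(2) gc by (simp add: o_def)
qed

text \<open>
  The descended left-invariant fields at \<open>\<Gamma>g\<close> are the derivative at \<open>1\<close> of the orbit map
  \<open>h \<mapsto> \<Gamma>gh\<close>. In this form they visibly depend on the coset \<open>\<Gamma>g\<close> alone.
\<close>
lemma field_eq:
  assumes g: "g \<in> carrier G"
  shows "field g = coord_deriv base_chart (chart_at quot (proj g)) (\<lambda>h. proj (g \<otimes> h)) \<one>"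
proof -
  obtain c where c: "lift_chart c" "chart_at quot (proj g) = push_chart c" "proj g \<in> fst (push_chart c)"
    using chart_at_quot[OF proj_in_rcosets[OF g]] .
  show ?thesis
    using orbit_deriv(2)[OF c(1) chart_at_M[OF g] c(3)] g
    unfolding quotient_field_def left_field_def tangent_map_def c(2) by simp
qed

lemma field_proj_cong:
  assumes "g \<in> carrier G" "h \<in> carrier G" "proj g = proj h"
  shows "field g = field h"
proof -
  obtain c where c: "lift_chart c" "chart_at quot (proj g) = push_chart c" "proj g \<in> fst (push_chart c)"
    using chart_at_quot[OF proj_in_rcosets[OF assms(1)]] .
  have "proj (g \<otimes> z) = proj (h \<otimes> z)" if "z \<in> fst base_chart" for z
    using that smooth_chart_subset[OF base_chart(1)] assms coset_mult_assoc[OF subgroup.subset[OF subgroup], of _ z]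
    by (metis subsetD)
  from smooth_near_cong(2)[OF orbit_deriv(1)[OF c(1) chart_at_M[OF assms(1)] c(3)] this]
  show ?thesis using assms c(2) by (simp add: field_eq)
qed

text \<open>
  The left-invariant frame at \<open>g\<close> in the coordinates of \<open>c\<close>. Its inverse is \<open>coframe c g\<close>.
\<close>
definition frame :: "('g, 'e) chart \<Rightarrow> 'g \<Rightarrow> ('e \<Rightarrow>\<^sub>L 'e)" where
  "frame c g = coord_deriv base_chart c (\<lambda>h. g \<otimes> h) \<one>"

definition coframe :: "('g, 'e) chart \<Rightarrow> 'g \<Rightarrow> ('e \<Rightarrow>\<^sub>L 'e)" where
  "coframe c g = coord_deriv c base_chart (\<lambda>h. inv g \<otimes> h) g"

lemma frame_coframe:
  assumes c: "smooth_chart M c" and g: "g \<in> fst c"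
  shows "coframe c g o\<^sub>L frame c g = id_blinfun" "frame c g o\<^sub>L coframe c g = id_blinfun"
proof -
  have gc: "g \<in> carrier G" "inv g \<in> carrier G" using g smooth_chart_subset[OF c] by auto
  have 1: "smooth_near base_chart c (\<lambda>h. g \<otimes> h) \<one>"
    using smooth_near_left_translation[OF base_chart(1) c gc(1) base_chart(2)] gc g by simp
  have 2: "smooth_near c base_chart (\<lambda>h. inv g \<otimes> h) g"
    using smooth_near_left_translation[OF c base_chart(1) gc(2) g] gc base_chart(2) by simp
  have gg: "g \<otimes> \<one> = g" "inv g \<otimes> g = \<one>" using gc by simp_all
  note i = smooth_chart_inj
  have e1: "((\<lambda>h. inv g \<otimes> h) \<circ> (\<lambda>h. g \<otimes> h)) z = id z" if "z \<in> fst base_chart" for z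
    using that gc smooth_chart_subset[OF base_chart(1)] by (auto simp: m_assoc[symmetric])
  have e2: "((\<lambda>h. g \<otimes> h) \<circ> (\<lambda>h. inv g \<otimes> h)) z = id z" if "z \<in> fst c" for z
    using that gc smooth_chart_subset[OF c] by (auto simp: m_assoc[symmetric])
  note A = smooth_near_compose[OF fd i[OF base_chart(1)] i[OF c] 1, where g = "\<lambda>h. inv g \<otimes> h", unfolded gg, OF 2]
  note B = smooth_near_compose[OF fd i[OF c] i[OF base_chart(1)] 2, where g = "\<lambda>h. g \<otimes> h", unfolded gg, OF 1]
  show "coframe c g o\<^sub>L frame c g = id_blinfun"
    unfolding frame_def coframe_def A(2)[symmetric]
      smooth_near_id(2)[OF smooth_chart_coord_chart[OF base_chart(1)] base_chart(2), symmetric]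
    by (rule smooth_near_cong(2)[OF A(1) e1])
  show "frame c g o\<^sub>L coframe c g = id_blinfun"
    unfolding frame_def coframe_def B(2)[symmetric]
      smooth_near_id(2)[OF smooth_chart_coord_chart[OF c] g, symmetric]
    by (rule smooth_near_cong(2)[OF B(1) e2])
qed

lemma to_from_chart:
  assumes c: "lift_chart c" and x: "x \<in> fst (push_chart c)"
  shows "to_chart quot (push_chart c) x o\<^sub>L from_chart quot (push_chart c) x = id_blinfun"
    and "from_chart quot (push_chart c) x o\<^sub>L to_chart quot (push_chart c) x = id_blinfun"
proof -
  have xr: "x \<in> rcosets \<Gamma>" using open_push_chart[OF c] x openin_subset topspace_quot by blast
  obtain d where d: "lift_chart d" "chart_at quot x = push_chart d" "x \<in> fst (push_chart d)"
    using chart_at_quot[OF xr] .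
  note cd = smooth_near_quot_id[OF c d(1) x d(3)] and dc = smooth_near_quot_id[OF d(1) c d(3) x]
  have cd': "smooth_near (push_chart c) (push_chart d) id (id x)"
    and dc': "smooth_near (push_chart d) (push_chart c) id (id x)" using cd dc by simp_all
  show "to_chart quot (push_chart c) x o\<^sub>L from_chart quot (push_chart c) x = id_blinfun"
    using smooth_near_compose(2)[OF fd inj_push_chart[OF c] inj_push_chart[OF d(1)] cd dc']
      smooth_near_id(2)[OF coord_chart_push_chart[OF c] x]
    unfolding to_chart_def from_chart_def d(2) id_comp unfolding id_apply by metis
  show "from_chart quot (push_chart c) x o\<^sub>L to_chart quot (push_chart c) x = id_blinfun"
    using smooth_near_compose(2)[OF fd inj_push_chart[OF d(1)] inj_push_chart[OF c] dc cd']
      smooth_near_id(2)[OF coord_chart_push_chart[OF d(1)] d(3)]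
    unfolding to_chart_def from_chart_def d(2) id_comp unfolding id_apply by metis
qed

lemma to_chart_field:
  assumes c: "lift_chart c" and g: "g \<in> fst c"
  shows "to_chart quot (push_chart c) (proj g) o\<^sub>L field g = frame c g"
proof -
  have c': "smooth_chart M c" using c unfolding lift_chart_def by blast
  have gc: "g \<in> carrier G" using g smooth_chart_subset[OF c'] by auto
  have x: "proj g \<in> fst (push_chart c)" using g by (simp add: fst_push_chart)
  obtain d where d: "lift_chart d" "chart_at quot (proj g) = push_chart d" "proj g \<in> fst (push_chart d)"
    using chart_at_quot[OF proj_in_rcosets[OF gc]] .
  have gg: "g \<otimes> \<one> = g" using gc by simp
  have "to_chart quot (push_chart c) (proj g) o\<^sub>L field g
      = coord_deriv (push_chart d) (push_chart c) id (proj g)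
        o\<^sub>L coord_deriv base_chart (push_chart d) (\<lambda>h. proj (g \<otimes> h)) \<one>"
    unfolding to_chart_def field_eq[OF gc] d(2) ..
  also have "\<dots> = coord_deriv base_chart (push_chart c) (\<lambda>h. proj (g \<otimes> h)) \<one>"
    using smooth_near_compose(2)[OF fd smooth_chart_inj[OF base_chart(1)] inj_push_chart[OF d(1)]
        orbit_deriv(1)[OF d(1) c' g d(3)], where g = id, unfolded gg, OF smooth_near_quot_id[OF d(1) c d(3) x]]
    by (simp add: o_def)
  also have "\<dots> = frame c g"
    using orbit_deriv(2)[OF c c' g x] smooth_near_proj_push(2)[OF c g] unfolding frame_def by simp
  finally show ?thesis .
qed

lemma field_invertible:
  assumes g: "g \<in> carrier G"
  obtains R where "R o\<^sub>L field g = id_blinfun" "field g o\<^sub>L R = id_blinfun"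
proof -
  obtain c where c: "lift_chart c" "g \<in> fst c" using lift_chart_exists[OF g] .
  have c': "smooth_chart M c" using c unfolding lift_chart_def by blast
  have x: "proj g \<in> fst (push_chart c)" using c by (simp add: fst_push_chart)
  let ?t = "to_chart quot (push_chart c) (proj g)" and ?f = "from_chart quot (push_chart c) (proj g)"
  note tf = to_from_chart[OF c(1) x] and t = to_chart_field[OF c] and fc = frame_coframe[OF c' c(2)]
  have Q: "field g = ?f o\<^sub>L frame c g"
    using tf(2) by (simp add: t[symmetric] blinfun_compose_assoc[symmetric])
  show ?thesis
  proof (rule that[of "coframe c g o\<^sub>L ?t"])
    show "(coframe c g o\<^sub>L ?t) o\<^sub>L field g = id_blinfun"
      using t fc by (simp add: blinfun_compose_assoc)
    have "field g o\<^sub>L (coframe c g o\<^sub>L ?t) = ?f o\<^sub>L ((frame c g o\<^sub>L coframe c g) o\<^sub>L ?t)"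
      by (simp add: Q blinfun_compose_assoc)
    then show "field g o\<^sub>L (coframe c g o\<^sub>L ?t) = id_blinfun"
      using fc tf by simp
  qed
qed

text \<open>
  The fields at \<open>\<Gamma>g\<close> are a linear isomorphism from the Lie algebra to the tangent space that depends on
  the coset alone, so \<open>J\<close> can be conjugated by it. The value \<open>0\<close> off the quotient is the one that \<^const>\<open>C_infinity\<close> prescribes.
\<close>
lemma representative_exists:
  obtains F where "represents G M \<Gamma> F J" "\<And>x. x \<notin> rcosets \<Gamma> \<Longrightarrow> F x = 0"
proof -
  have "\<exists>T. (x \<in> rcosets \<Gamma> \<longrightarrow> (\<forall>g\<in>carrier G. proj g = x \<longrightarrow> J x o\<^sub>L field g = field g o\<^sub>L T)) \<and>
      (x \<notin> rcosets \<Gamma> \<longrightarrow> T = 0)" for x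
  proof (cases "x \<in> rcosets \<Gamma>")
    case True
    then obtain g where g: "g \<in> carrier G" "x = proj g" by (rule rcosetsE)
    obtain R where R: "R o\<^sub>L field g = id_blinfun" "field g o\<^sub>L R = id_blinfun"
      using field_invertible[OF g(1)] .
    have "J x o\<^sub>L field h = field h o\<^sub>L (R o\<^sub>L (J x o\<^sub>L field g))" if "h \<in> carrier G" "proj h = x" for h
    proof -
      have "field h = field g" using that g by (intro field_proj_cong) auto
      then show ?thesis using R by (simp add: blinfun_compose_assoc[symmetric])
    qed
    then show ?thesis using True by blast
  qed blast
  then obtain F where F: "\<And>x g. x \<in> rcosets \<Gamma> \<Longrightarrow> g \<in> carrier G \<Longrightarrow> proj g = x \<Longrightarrow> J x o\<^sub>L field g = field g o\<^sub>L F x"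
    "\<And>x. x \<notin> rcosets \<Gamma> \<Longrightarrow> F x = 0" by metis
  show ?thesis
    by (rule that[of F]) (use F proj_in_rcosets in \<open>auto simp: represents_def\<close>)
qed

text \<open>
  Both are partial derivatives of smooth maps of two variables, multiplication and left division.
\<close>
lemma smooth_frame:
  assumes c: "smooth_chart M c"
  shows "smooth_on (snd c ` fst c) (\<lambda>y. frame c (inv_chart c y))"
    and "smooth_on (snd c ` fst c) (\<lambda>y. coframe c (inv_chart c y))"
proof -
  note i = smooth_chart_inj
  note op = coord_chart_open_image[OF smooth_chart_coord_chart[OF c]]
    coord_chart_open_image[OF smooth_chart_coord_chart[OF base_chart(1)]]
  have b: "inv_chart base_chart (snd base_chart \<one>) = \<one>"
    using i[OF base_chart(1)] base_chart(2) by simp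
  show "smooth_on (snd c ` fst c) (\<lambda>y. frame c (inv_chart c y))"
  proof (rule smooth_on_local)
    fix y assume "y \<in> snd c ` fst c"
    then obtain g where g: "g \<in> fst c" "y = snd c g" by blast
    then have gc: "g \<in> carrier G" using smooth_chart_subset[OF c] by auto
    have "smooth_near (prod_chart c base_chart) c (\<lambda>(g, h). g \<otimes> h) (g, \<one>)"
      by (rule smooth_near_mult[OF c base_chart(1) c g(1) base_chart(2)]) (use g gc in simp)
    from smooth_partial_coord_deriv[OF fd fd i[OF c] i[OF base_chart(1)] op(2) this op(1), where \<kappa> = "\<lambda>_. snd base_chart \<one>"]
    have "\<exists>T. open T \<and> snd c g \<in> T \<and> smooth_on T
       (\<lambda>y. coord_deriv base_chart c (\<lambda>w. inv_chart c y \<otimes> w) (inv_chart base_chart (snd base_chart \<one>)))"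
      using g by (simp add: smooth_on_const)
    then show "\<exists>T. open T \<and> y \<in> T \<and> smooth_on T (\<lambda>y. frame c (inv_chart c y))"
      unfolding frame_def g(2) b .
  qed
  show "smooth_on (snd c ` fst c) (\<lambda>y. coframe c (inv_chart c y))"
  proof (rule smooth_on_local)
    fix y assume "y \<in> snd c ` fst c"
    then obtain g where g: "g \<in> fst c" "y = snd c g" by blast
    then have gc: "g \<in> carrier G" using smooth_chart_subset[OF c] by auto
    have "smooth_near (prod_chart c c) base_chart (\<lambda>(g, h). inv g \<otimes> h) (g, g)"
      by (rule smooth_near_left_divide[OF c c base_chart(1) g(1) g(1)]) (use g gc base_chart(2) in simp)
    from smooth_partial_coord_deriv[OF fd fd i[OF c] i[OF c] op(1) this op(1), where \<kappa> = "\<lambda>y. y"]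
    have "\<exists>T. open T \<and> snd c g \<in> T \<and> smooth_on T
       (\<lambda>y. coord_deriv c base_chart (\<lambda>w. inv (inv_chart c y) \<otimes> w) (inv_chart c y))"
      using g op by (simp add: smooth_on_ident)
    then show "\<exists>T. open T \<and> y \<in> T \<and> smooth_on T (\<lambda>y. coframe c (inv_chart c y))"
      unfolding coframe_def g(2) .
  qed
qed

text \<open>
  In coordinates \<open>F\<close> is the product of the coframe, the coordinate expression of \<open>J\<close> and the frame.
\<close>
lemma representative_smooth:
  assumes J: "smooth_endo quot J" and F: "represents G M \<Gamma> F J" and zero: "\<And>x. x \<notin> rcosets \<Gamma> \<Longrightarrow> F x = 0"
  shows "F \<in> C_infinity quot"
  unfolding C_infinity_def
proof (intro CollectI conjI allI ballI impI)
  show "F x = 0" if "x \<notin> topspace (mtop quot)" for x using that zero topspace_quot by simp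
  fix c' assume "c' \<in> atlas quot"
  then obtain c where c: "lift_chart c" "c' = push_chart c" unfolding atlas_quot by blast
  have sc: "smooth_chart M c" using c unfolding lift_chart_def by blast
  note op = coord_chart_open_image[OF smooth_chart_coord_chart[OF sc]]
  let ?g = "inv_chart c"
  let ?J = "\<lambda>x. to_chart quot c' x o\<^sub>L J x o\<^sub>L from_chart quot c' x"
  have im: "snd c' ` fst c' = snd c ` fst c" using image_push_chart[OF c(1)] c(2) by simp
  have "smooth_on (snd c ` fst c) (?J \<circ> inv_chart c')"
    using J push_chart_in_atlas[OF c(1)] unfolding smooth_endo_def c(2)[symmetric] im[symmetric] by blast
  then have "smooth_on (snd c ` fst c) (\<lambda>y. coframe c (?g y) o\<^sub>L ((?J \<circ> inv_chart c') y o\<^sub>L frame c (?g y)))"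
    by (intro smooth_on_blinfun_compose op smooth_frame[OF sc])
  then have "smooth_on (snd c ` fst c) (F \<circ> inv_chart c')"
  proof (rule smooth_on_cong[OF op, rotated])
    fix y assume y: "y \<in> snd c ` fst c"
    define g where "g = ?g y"
    have g: "g \<in> fst c" unfolding g_def using y by (rule inv_into_into)
    have x: "inv_chart c' y = proj g" using inv_push_chart[OF c(1) y] c(2) g_def by simp
    have px: "proj g \<in> fst (push_chart c)" using g by (simp add: fst_push_chart)
    have gc: "g \<in> carrier G" using g smooth_chart_subset[OF sc] by auto
    let ?t = "to_chart quot c' (proj g)" and ?f = "from_chart quot c' (proj g)"
    have t: "?t o\<^sub>L field g = frame c g" using to_chart_field[OF c(1) g] c(2) by simp
    have ft: "?f o\<^sub>L ?t = id_blinfun" using to_from_chart(2)[OF c(1) px] c(2) by simp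
    have rep: "J (proj g) o\<^sub>L field g = field g o\<^sub>L F (proj g)" using F gc unfolding represents_def by blast
    have "coframe c g o\<^sub>L (?J (proj g) o\<^sub>L frame c g)
      = coframe c g o\<^sub>L (?t o\<^sub>L (J (proj g) o\<^sub>L ((?f o\<^sub>L ?t) o\<^sub>L field g)))"
      unfolding t[symmetric] by (simp add: blinfun_compose_assoc)
    also have "\<dots> = coframe c g o\<^sub>L ((?t o\<^sub>L field g) o\<^sub>L F (proj g))"
      by (simp add: ft rep blinfun_compose_assoc)
    also have "\<dots> = F (proj g)"
      using frame_coframe(1)[OF sc g] by (simp add: t blinfun_compose_assoc[symmetric])
    finally show "coframe c (?g y) o\<^sub>L ((?J \<circ> inv_chart c') y o\<^sub>L frame c (?g y)) = (F \<circ> inv_chart c') y"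
      using x g_def by simp
  qed
  then show "smooth_on (snd c' ` fst c') (F \<circ> inv_chart c')" unfolding im .
qed

lemma C_infinity_continuous:
  assumes F: "(F :: 'g set \<Rightarrow> 'v::real_normed_vector) \<in> C_infinity quot"
  shows "continuous_map (mtop quot) euclidean F"
  unfolding continuous_map
proof (intro conjI allI impI)
  fix P :: "'v set" assume "openin euclidean P"
  then have P: "open P" by simp
  have "openin (mtop M) {g \<in> carrier G. F (proj g) \<in> P}"
  proof (subst openin_subopen, intro ballI)
    fix g assume "g \<in> {g \<in> carrier G. F (proj g) \<in> P}"
    then have g: "g \<in> carrier G" "F (proj g) \<in> P" by auto
    obtain c where c: "lift_chart c" "g \<in> fst c" using lift_chart_exists[OF g(1)] .
    have sc: "smooth_chart M c" using c unfolding lift_chart_def by blast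
    note op = coord_chart_open_image[OF smooth_chart_coord_chart[OF sc]]
    let ?F = "F \<circ> inv_chart (push_chart c)"
    have "smooth_on (snd c ` fst c) ?F"
      using F push_chart_in_atlas[OF c(1)] image_push_chart[OF c(1)] unfolding C_infinity_def by auto
    then have "open (snd c ` fst c \<inter> ?F -` P)"
      by (intro continuous_open_preimage[OF smooth_on_continuous op P])
    then have "openin (top_of_set (snd c ` fst c)) (snd c ` fst c \<inter> ?F -` P)"
      by (auto simp: openin_open)
    moreover have "continuous_map (subtopology (mtop M) (fst c)) (top_of_set (snd c ` fst c)) (snd c)"
      using smooth_chart_is_chart[OF sc] unfolding is_chart_def by (blast intro: homeomorphic_imp_continuous_map)
    ultimately have "openin (subtopology (mtop M) (fst c))
        {h \<in> topspace (subtopology (mtop M) (fst c)). snd c h \<in> snd c ` fst c \<inter> ?F -` P}"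
      by (intro openin_continuous_map_preimage)
    moreover have "{h \<in> topspace (subtopology (mtop M) (fst c)). snd c h \<in> snd c ` fst c \<inter> ?F -` P}
      = {h \<in> fst c. F (proj h) \<in> P}"
    proof -
      have "?F (snd c h) = F (proj h)" if "h \<in> fst c" for h
        using that inv_push_chart[OF c(1), of "snd c h"] smooth_chart_inj[OF sc] by simp
      then show ?thesis using smooth_chart_subset[OF sc] by (auto simp: topspace_M simp del: o_apply dest: inj_onD[OF smooth_chart_inj[OF sc]])
    qed
    ultimately have "openin (mtop M) {h \<in> fst c. F (proj h) \<in> P}"
      using smooth_chart_open[OF sc] by (simp add: openin_open_subtopology)
    then show "\<exists>T. openin (mtop M) T \<and> g \<in> T \<and> T \<subseteq> {g \<in> carrier G. F (proj g) \<in> P}"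
      using g c smooth_chart_subset[OF sc] by blast
  qed
  moreover have "{g \<in> carrier G. proj g \<in> {x \<in> topspace (mtop quot). F x \<in> P}} = {g \<in> carrier G. F (proj g) \<in> P}"
    using proj_in_rcosets topspace_quot by auto
  ultimately show "openin (mtop quot) {x \<in> topspace (mtop quot). F x \<in> P}"
    unfolding openin_quot using topspace_quot by auto
qed simp

lemma C_infinity_subspace: "subspace (C_infinity quot :: ('g set \<Rightarrow> 'v::real_normed_vector) set)"
  unfolding subspace_def C_infinity_def
proof (intro conjI ballI allI CollectI)
  have op: "open (snd c ` fst c)" if "c \<in> atlas quot" for c
    using that coord_chart_open_image[OF coord_chart_push_chart] unfolding atlas_quot by auto
  show "smooth_on (snd c ` fst c) ((0 :: 'g set \<Rightarrow> 'v) \<circ> inv_chart c)" for c :: "('g set, 'e) chart"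
    by (simp add: zero_fun_def o_def smooth_on_const)
  fix F H :: "'g set \<Rightarrow> 'v" and c r
  assume F: "F \<in> {F. (\<forall>x. x \<notin> topspace (mtop quot) \<longrightarrow> F x = 0) \<and>
     (\<forall>c\<in>atlas quot. smooth_on (snd c ` fst c) (F \<circ> inv_chart c))}" and c: "c \<in> atlas quot"
  show "smooth_on (snd c ` fst c) (r *\<^sub>R F \<circ> inv_chart c)"
    using smooth_on_scaleR[OF op[OF c], of "F \<circ> inv_chart c" r] F c by (simp add: scaleR_fun_def o_def)
  assume H: "H \<in> {F. (\<forall>x. x \<notin> topspace (mtop quot) \<longrightarrow> F x = 0) \<and>
     (\<forall>c\<in>atlas quot. smooth_on (snd c ` fst c) (F \<circ> inv_chart c))}"
  show "smooth_on (snd c ` fst c) (F + H \<circ> inv_chart c)"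
    using smooth_on_add[OF op[OF c], of "F \<circ> inv_chart c" "H \<circ> inv_chart c"] F H c
    by (simp add: plus_fun_def o_def)
qed (auto simp: scaleR_fun_def)

section \<open>Affine automorphisms\<close>

text \<open>
  The inverse of \<open>L\<close> is the derivative of the inverse automorphism.
\<close>
lemma smooth_automorphism_deriv:
  assumes \<Phi>: "lie_group_automorphism G M \<Phi>"
  defines "L \<equiv> tangent_map M M \<Phi> \<one>"
  shows "smooth_near base_chart base_chart \<Phi> \<one>" "L = coord_deriv base_chart base_chart \<Phi> \<one>"
    "\<exists>L'. L o\<^sub>L L' = id_blinfun \<and> L' o\<^sub>L L = id_blinfun"
proof -
  have hom: "\<Phi> \<in> hom G G" and dif: "diffeo M M \<Phi>" and bij: "bij_betw \<Phi> (carrier G) (carrier G)"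
    using \<Phi> unfolding lie_group_automorphism_def iso_def by auto
  have \<Phi>1: "\<Phi> \<one> = \<one>" using hom_one[OF hom is_group is_group] .
  let ?\<Psi> = "inv_into (carrier G) \<Phi>"
  have sm: "smooth_map M M \<Phi>" "smooth_map M M ?\<Psi>"
    using dif unfolding diffeo_def topspace_M by auto
  have \<Psi>1: "?\<Psi> \<one> = \<one>" using bij \<Phi>1 by (metis bij_betw_inv_into_left one_closed)
  show L: "L = coord_deriv base_chart base_chart \<Phi> \<one>"
    unfolding L_def tangent_map_def \<Phi>1 ..
  note b = base_chart and i = smooth_chart_inj[OF base_chart(1)]
  note sub = subsetD[OF smooth_chart_subset[OF b(1)]]
  show 1: "smooth_near base_chart base_chart \<Phi> \<one>"
    by (rule smooth_map_smooth_near_smooth_chart[OF mfd mfd sm(1) b(1) b(1) b(2)]) (use b \<Phi>1 in simp)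
  have 2: "smooth_near base_chart base_chart ?\<Psi> \<one>"
    by (rule smooth_map_smooth_near_smooth_chart[OF mfd mfd sm(2) b(1) b(1) b(2)]) (use b \<Psi>1 in simp)
  note idd = smooth_near_id(2)[OF smooth_chart_coord_chart[OF b(1)] b(2)]
  note A = smooth_near_compose[OF fd i i 1, where g = ?\<Psi>, unfolded \<Phi>1, OF 2]
  note B = smooth_near_compose[OF fd i i 2, where g = \<Phi>, unfolded \<Psi>1, OF 1]
  have "coord_deriv base_chart base_chart ?\<Psi> \<one> o\<^sub>L L = id_blinfun"
    unfolding L A(2)[symmetric] idd[symmetric]
    by (rule smooth_near_cong(2)[OF A(1)]) (use bij sub in \<open>simp add: bij_betw_inv_into_left\<close>)
  moreover have "L o\<^sub>L coord_deriv base_chart base_chart ?\<Psi> \<one> = id_blinfun"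
    unfolding L B(2)[symmetric] idd[symmetric]
    by (rule smooth_near_cong(2)[OF B(1)]) (use bij sub in \<open>simp add: bij_betw_inv_into_right\<close>)
  ultimately show "\<exists>L'. L o\<^sub>L L' = id_blinfun \<and> L' o\<^sub>L L = id_blinfun" by blast
qed

text \<open>
  \<open>A\<close> carries the orbit map \<open>h \<mapsto> \<Gamma>gh\<close> to \<open>h \<mapsto> \<Gamma>g'\<Phi>(h)\<close> with \<open>g' = g\<^sub>0\<Phi>(g)\<close>. By the chain rule the
  derivative of \<open>A\<close> is the constant map \<open>L\<close> in the trivialization.
\<close>
lemma representative_equivariant:
  assumes A: "smooth_map quot quot A"
    and \<Phi>: "lie_group_automorphism G M \<Phi>" and g0: "g0 \<in> carrier G"
    and A_eq: "\<And>g. g \<in> carrier G \<Longrightarrow> A (proj g) = proj (g0 \<otimes> \<Phi> g)"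
    and inv: "\<And>x. x \<in> rcosets \<Gamma> \<Longrightarrow> tangent_map quot quot A x o\<^sub>L J x = J (A x) o\<^sub>L tangent_map quot quot A x"
    and F: "represents G M \<Gamma> F J" and x: "x \<in> rcosets \<Gamma>"
  shows "F (A x) o\<^sub>L tangent_map M M \<Phi> \<one> = tangent_map M M \<Phi> \<one> o\<^sub>L F x"
proof -
  let ?L = "tangent_map M M \<Phi> \<one>" and ?D = "tangent_map quot quot A x"
  obtain g where g: "g \<in> carrier G" "x = proj g" using x by (rule rcosetsE)
  have hom: "\<Phi> \<in> hom G G" using \<Phi> unfolding lie_group_automorphism_def iso_def by auto
  have \<Phi>1: "\<Phi> \<one> = \<one>" using hom_one[OF hom is_group is_group] .
  define g' where "g' = g0 \<otimes> \<Phi> g"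
  have g': "g' \<in> carrier G" unfolding g'_def using g g0 hom by (auto simp: hom_def)
  have Ax: "A x = proj g'" using A_eq g g'_def by simp
  have Axr: "A x \<in> rcosets \<Gamma>" using Ax g' proj_in_rcosets by simp
  obtain c where c: "lift_chart c" "chart_at quot x = push_chart c" "x \<in> fst (push_chart c)"
    using chart_at_quot[OF x] .
  obtain d where d: "lift_chart d" "chart_at quot (A x) = push_chart d" "A x \<in> fst (push_chart d)"
    using chart_at_quot[OF Axr] .
  note b = base_chart and i = smooth_chart_inj[OF base_chart(1)]
  have sA: "smooth_near (push_chart c) (push_chart d) A x"
    by (rule smooth_map_smooth_near[OF A push_chart_in_atlas[OF c(1)] push_chart_in_atlas[OF d(1)]
          coord_chart_push_chart[OF c(1)] open_push_chart[OF d(1)] c(3) d(3)])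
  have gg: "proj (g \<otimes> \<one>) = x" using g by simp
  note P = smooth_near_compose[OF fd i inj_push_chart[OF c(1)]
      orbit_deriv(1)[OF c(1) chart_at_M[OF g(1)] c(3)[unfolded g(2)]], where g = A, unfolded gg, OF sA]
  note S = smooth_near_compose[OF fd i i smooth_automorphism_deriv(1)[OF \<Phi>],
      where g = "\<lambda>h. proj (g' \<otimes> h)", unfolded \<Phi>1,
      OF orbit_deriv(1)[OF d(1) chart_at_M[OF g'] d(3)[unfolded Ax]]]
  have "(A \<circ> (\<lambda>h. proj (g \<otimes> h))) z = ((\<lambda>h. proj (g' \<otimes> h)) \<circ> \<Phi>) z" if "z \<in> fst base_chart" for z
  proof -
    have z: "z \<in> carrier G" using that smooth_chart_subset[OF b(1)] by auto
    then have "\<Phi> (g \<otimes> z) = \<Phi> g \<otimes> \<Phi> z" "\<Phi> g \<in> carrier G" "\<Phi> z \<in> carrier G" using hom g by (auto simp: hom_def)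
    then show ?thesis using A_eq[of "g \<otimes> z"] z g g0 by (simp add: g'_def m_assoc)
  qed
  from smooth_near_cong(2)[OF P(1) this]
  have "?D o\<^sub>L field g = field g' o\<^sub>L ?L"
    unfolding P(2) S(2) tangent_map_def[of quot] c(2) d(2) field_eq[OF g(1)] field_eq[OF g']
      smooth_automorphism_deriv(2)[OF \<Phi>] g(2)[symmetric] Ax[symmetric] .
  note D = this
  have rg: "J x o\<^sub>L field g = field g o\<^sub>L F x" and rg': "J (A x) o\<^sub>L field g' = field g' o\<^sub>L F (A x)"
    using F g g' Ax unfolding represents_def by auto
  have "field g' o\<^sub>L (F (A x) o\<^sub>L ?L) = J (A x) o\<^sub>L (field g' o\<^sub>L ?L)"
    by (simp only: blinfun_compose_assoc[symmetric] rg')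
  also have "\<dots> = (J (A x) o\<^sub>L ?D) o\<^sub>L field g" by (simp only: D[symmetric] blinfun_compose_assoc)
  also have "\<dots> = ?D o\<^sub>L (J x o\<^sub>L field g)" by (simp only: inv[OF x, symmetric] blinfun_compose_assoc)
  also have "\<dots> = (field g' o\<^sub>L ?L) o\<^sub>L F x" by (simp only: rg D[symmetric] blinfun_compose_assoc)
  finally have eq: "field g' o\<^sub>L (F (A x) o\<^sub>L ?L) = field g' o\<^sub>L (?L o\<^sub>L F x)" by (simp only: blinfun_compose_assoc)
  obtain R where R: "R o\<^sub>L field g' = id_blinfun" using field_invertible[OF g'] .
  have "R o\<^sub>L (field g' o\<^sub>L (F (A x) o\<^sub>L ?L)) = R o\<^sub>L (field g' o\<^sub>L (?L o\<^sub>L F x))" using eq by simp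
  then show ?thesis using R by (simp add: blinfun_compose_assoc[symmetric])
qed

end

section \<open>Ergodic theory\<close>

lemma measure_preserving_funpow:
  assumes "measure_preserving m A"
  shows "A ^^ k \<in> measurable m m" and "distr m m (A ^^ k) = m"
proof -
  have A: "A \<in> measurable m m" "distr m m A = m" using assms unfolding measure_preserving_def by auto
  have "A ^^ k \<in> measurable m m \<and> distr m m (A ^^ k) = m"
  proof (induction k)
    case 0
    then show ?case by (simp add: id_def distr_id)
  next
    case (Suc k)
    then have k: "A ^^ k \<in> measurable m m" "distr m m (A ^^ k) = m" by auto
    have "distr m m (A ^^ Suc k) = distr (distr m m (A ^^ k)) m A"
      using distr_distr[of A m m "A ^^ k" m] A k by (simp add: o_def)
    then show ?case using A k measurable_comp[OF k(1) A(1)] by (simp add: o_def)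
  qed
  then show "A ^^ k \<in> measurable m m" "distr m m (A ^^ k) = m" by auto
qed

lemma measure_preserving_vimage:
  assumes "measure_preserving m A" "S \<in> sets m"
  shows "(A ^^ k) -` S \<inter> space m \<in> sets m" "measure m ((A ^^ k) -` S \<inter> space m) = measure m S"
  using measurable_sets[OF measure_preserving_funpow(1)[OF assms(1)] assms(2)]
    measure_distr[OF measure_preserving_funpow(1)[OF assms(1)] assms(2)]
    measure_preserving_funpow(2)[OF assms(1)] by simp_all

text \<open>
  The points that visit \<open>U\<close> infinitely often form a set \<open>S\<close> with \<open>A\<inverse>(S) = S\<close> exactly, as
  \<^const>\<open>ergodic\<close> demands, while for the points that visit it at least once only \<open>A\<inverse>(S) \<subseteq> S\<close> is
  clear. Each of the decreasing
  sets \<open>V n\<close> contains a preimage of \<open>U\<close>, so \<open>S\<close> has at least the measure of \<open>U\<close>.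
\<close>
lemma ergodic_orbit_visits:
  assumes m: "prob_space m" and erg: "ergodic m A" and U: "U \<in> sets m" "measure m U > 0"
  shows "AE x in m. \<exists>k. (A ^^ k) x \<in> U"
proof -
  interpret prob_space m by (rule m)
  have mp: "measure_preserving m A" using erg unfolding ergodic_def by blast
  have Asp: "A x \<in> space m" if "x \<in> space m" for x
    using mp that unfolding measure_preserving_def by (auto dest: measurable_space)
  define V where "V n = (\<Union>k\<in>{n..}. (A ^^ k) -` U \<inter> space m)" for n
  define S where "S = (\<Inter>n. V n)"
  have V: "V n \<in> sets m" for n
    unfolding V_def by (intro sets.countable_UN'') (auto intro: measure_preserving_vimage[OF mp U(1)])
  have S: "S \<in> sets m" unfolding S_def using V by (intro sets.countable_INT) auto
  have "A -` S \<inter> space m = S"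
  proof
    show "A -` S \<inter> space m \<subseteq> S"
    proof
      fix x assume x: "x \<in> A -` S \<inter> space m"
      have "\<exists>k\<ge>n. (A ^^ k) x \<in> U" for n
      proof -
        have "A x \<in> V n" using x unfolding S_def by blast
        then obtain k where "k \<ge> n" "(A ^^ k) (A x) \<in> U" unfolding V_def by blast
        then show ?thesis by (intro exI[of _ "Suc k"]) (simp add: funpow_swap1)
      qed
      then show "x \<in> S" using x unfolding S_def V_def by auto
    qed
    show "S \<subseteq> A -` S \<inter> space m"
    proof
      fix x assume x: "x \<in> S"
      then have xs: "x \<in> space m" using sets.sets_into_space[OF S] by blast
      have "\<exists>k\<ge>n. (A ^^ k) (A x) \<in> U" for n
      proof -
        have "x \<in> V (Suc n)" using x unfolding S_def by blast
        then obtain k where "k \<ge> Suc n" "(A ^^ k) x \<in> U" unfolding V_def by blast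
        then show ?thesis by (cases k) (auto simp: funpow_swap1)
      qed
      then show "x \<in> A -` S \<inter> space m" using xs Asp unfolding S_def V_def by auto
    qed
  qed
  then have S01: "measure m S = 0 \<or> measure m S = 1" using erg S unfolding ergodic_def by blast
  have "(\<lambda>n. measure m (V n)) \<longlonglongrightarrow> measure m S"
    unfolding S_def
  proof (rule finite_Lim_measure_decseq)
    show "range V \<subseteq> sets m" using V by blast
    show "decseq V" unfolding decseq_def V_def by (meson UN_mono atLeast_subset_iff subset_refl)
  qed
  moreover have "measure m U \<le> measure m (V n)" for n
  proof -
    have "measure m U = measure m ((A ^^ n) -` U \<inter> space m)"
      by (rule measure_preserving_vimage(2)[OF mp U(1), symmetric])
    also have "\<dots> \<le> measure m (V n)" by (rule finite_measure_mono[OF _ V]) (auto simp: V_def)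
    finally show ?thesis .
  qed
  ultimately have "measure m U \<le> measure m S" by (intro LIMSEQ_le_const) auto
  then have "measure m S = 1" using S01 U(2) by linarith
  then have "AE x in m. x \<in> S" by (rule AE_prob_1)
  then show ?thesis by eventually_elim (auto simp: S_def V_def)
qed

text \<open>
  For a countable pseudobase \<open>\<B>\<close> of open sets this is a point with a dense orbit.
\<close>
lemma ergodic_dense_orbit:
  assumes m: "prob_space m" and erg: "ergodic m A" and "countable \<B>"
    and \<B>: "\<And>U. U \<in> \<B> \<Longrightarrow> U \<in> sets m \<and> measure m U > 0"
  obtains x where "x \<in> space m" "\<And>U. U \<in> \<B> \<Longrightarrow> \<exists>k. (A ^^ k) x \<in> U"
proof -
  interpret prob_space m by (rule m)
  have "AE x in m. \<forall>U\<in>\<B>. \<exists>k. (A ^^ k) x \<in> U"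
    using assms(3) \<B> by (subst AE_ball_countable) (auto intro: ergodic_orbit_visits[OF m erg])
  then have "AE x in m. x \<in> space m \<and> (\<forall>U\<in>\<B>. \<exists>k. (A ^^ k) x \<in> U)" using AE_space by eventually_elim auto
  then show ?thesis using eventually_happens'[OF ae_filter_bot] that by blast
qed

text \<open>
  The iterates \<open>T\<^sup>-\<^sup>k\<close> are uniformly bounded on the span of the image of \<open>F\<close>. A basis of the span can
  be chosen inside the image, and as \<open>A\<close> is onto, its members are \<open>F(A\<^sup>k z) = T\<^sup>k(F z)\<close>; so \<open>T\<^sup>-\<^sup>k\<close>
  maps the basis into the bounded image again, and the coordinates of \<open>F(A\<^sup>k x) - F(A\<^sup>k y)\<close> are
  bounded by its norm.
\<close>
lemma equivariant_expansion_bound: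
  fixes F :: "'x \<Rightarrow> 'v::real_normed_vector"
  assumes fd: "fin_dim (UNIV :: 'v set)" and bd: "bounded (F ` X)" and A: "A ` X = X"
    and T: "linear T" "inj T" and FA: "\<And>x. x \<in> X \<Longrightarrow> F (A x) = T (F x)"
  obtains C where "C > 0"
    "\<And>k x y. x \<in> X \<Longrightarrow> y \<in> X \<Longrightarrow> norm (F x - F y) \<le> C * norm (F ((A ^^ k) x) - F ((A ^^ k) y))"
proof -
  have fdX: "fin_dim (F ` X)" using fd unfolding fin_dim_def by blast
  obtain B where B: "finite B" "independent B" "B \<subseteq> F ` X" "F ` X \<subseteq> span B"
    by (rule fin_dim_basis[OF fdX])
  obtain C where C: "\<And>c b. b \<in> B \<Longrightarrow> \<bar>c b\<bar> \<le> C * norm (\<Sum>b\<in>B. c b *\<^sub>R b)"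
    using independent_coordinates_bounded[OF B(1,2)] by blast
  obtain D where D: "\<And>x. x \<in> X \<Longrightarrow> norm (F x) \<le> D" using bd unfolding bounded_iff by auto
  have AkX: "(A ^^ k) ` X = X" for k
    by (induction k) (simp_all add: A image_comp[symmetric] del: o_apply)
  have Tk: "linear (T ^^ k)" "inj (T ^^ k)" for k
    using T by (induction k) (auto simp: linear_compose id_def linear_ident inj_compose)
  have FAk: "F ((A ^^ k) x) = (T ^^ k) (F x)" if "x \<in> X" for k x
  proof (induction k)
    case (Suc k)
    have "(A ^^ k) x \<in> X" using AkX that by blast
    then show ?case using Suc FA by simp
  qed simp
  \<comment> \<open>The summand \<open>1\<close> makes the constant positive also when \<open>F\<close> vanishes.\<close>
  let ?K = "real (card B) * \<bar>C\<bar> * \<bar>D\<bar> + 1"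
  have "norm (F x - F y) \<le> ?K * norm (F ((A ^^ k) x) - F ((A ^^ k) y))" if xy: "x \<in> X" "y \<in> X" for k x y
  proof -
    let ?w = "F ((A ^^ k) x) - F ((A ^^ k) y)"
    have "(A ^^ k) x \<in> X" "(A ^^ k) y \<in> X" using AkX xy by blast+
    then have "?w \<in> span B" using B(4) by (intro span_diff) auto
    then obtain c where w: "?w = (\<Sum>b\<in>B. c b *\<^sub>R b)" using span_finite[OF B(1)] by auto
    have "\<forall>b\<in>B. \<exists>z\<in>X. b = F ((A ^^ k) z)"
    proof
      fix b assume "b \<in> B"
      then obtain x where "x \<in> X" "b = F x" using B(3) by blast
      moreover have "x \<in> (A ^^ k) ` X" using \<open>x \<in> X\<close> AkX by simp
      ultimately show "\<exists>z\<in>X. b = F ((A ^^ k) z)" by blast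
    qed
    then obtain z where z: "\<And>b. b \<in> B \<Longrightarrow> z b \<in> X" "\<And>b. b \<in> B \<Longrightarrow> b = F ((A ^^ k) (z b))" by metis
    interpret l: linear "T ^^ k" by (rule Tk(1))
    have "(T ^^ k) (F x - F y) = ?w" using FAk xy by (simp add: l.diff)
    also have "\<dots> = (\<Sum>b\<in>B. c b *\<^sub>R (T ^^ k) (F (z b)))"
      unfolding w using z FAk by (intro sum.cong refl) metis
    also have "\<dots> = (T ^^ k) (\<Sum>b\<in>B. c b *\<^sub>R F (z b))" by (simp add: l.sum l.scale)
    finally have "F x - F y = (\<Sum>b\<in>B. c b *\<^sub>R F (z b))" using Tk(2) by (auto dest: injD)
    then have "norm (F x - F y) \<le> (\<Sum>b\<in>B. norm (c b *\<^sub>R F (z b)))" by (simp only: norm_sum)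
    also have "\<dots> \<le> (\<Sum>b\<in>B. (\<bar>C\<bar> * norm ?w) * \<bar>D\<bar>)"
    proof (rule sum_mono)
      fix b assume b: "b \<in> B"
      have "\<bar>c b\<bar> \<le> C * norm ?w" using C[OF b, of c] w by simp
      also have "\<dots> \<le> \<bar>C\<bar> * norm ?w" by (intro mult_right_mono) auto
      finally have "\<bar>c b\<bar> \<le> \<bar>C\<bar> * norm ?w" .
      moreover have "norm (F (z b)) \<le> \<bar>D\<bar>" using D[OF z(1)[OF b]] by linarith
      ultimately show "norm (c b *\<^sub>R F (z b)) \<le> (\<bar>C\<bar> * norm ?w) * \<bar>D\<bar>"
        by (simp add: mult_mono)
    qed
    also have "\<dots> = real (card B) * \<bar>C\<bar> * \<bar>D\<bar> * norm ?w" by simp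
    also have "\<dots> \<le> ?K * norm ?w" by (intro mult_right_mono) auto
    finally show ?thesis .
  qed
  moreover have "?K > 0" by (simp add: add_nonneg_pos)
  ultimately show ?thesis using that by blast
qed

text \<open>
  Up to the factor \<open>C\<close>, points whose \<open>F\<close>-values are far apart stay so under \<open>A\<^sup>k\<close>. So no \<open>A\<^sup>-\<^sup>k S\<close> can
  meet both \<open>S\<close> and \<open>S'\<close>, and the sum of the two correlation errors is bounded below by a
  positive \<open>\<delta>\<close> independent of \<open>k\<close>. Its Cesaro means cannot tend to \<open>0\<close>.
\<close>
lemma weakly_mixing_equivariant_constant:
  fixes F :: "'x \<Rightarrow> 'v::real_normed_vector"
  assumes m: "prob_space m" and wm: "weakly_mixing m A" and A: "A ` space m = space m"
    and meas: "\<And>P. open P \<Longrightarrow> {x \<in> space m. F x \<in> P} \<in> sets m"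
    and pos: "\<And>P x. open P \<Longrightarrow> x \<in> space m \<Longrightarrow> F x \<in> P \<Longrightarrow> measure m {x \<in> space m. F x \<in> P} > 0"
    and fd: "fin_dim (UNIV :: 'v set)" and bd: "bounded (F ` space m)"
    and T: "linear T" "inj T" and FA: "\<And>x. x \<in> space m \<Longrightarrow> F (A x) = T (F x)"
    and pq: "p \<in> space m" "q \<in> space m"
  shows "F p = F q"
proof (rule ccontr)
  assume ne: "F p \<noteq> F q"
  interpret prob_space m by (rule m)
  obtain C where C: "C > 0"
    "\<And>k x y. x \<in> space m \<Longrightarrow> y \<in> space m \<Longrightarrow> norm (F x - F y) \<le> C * norm (F ((A ^^ k) x) - F ((A ^^ k) y))"
    by (rule equivariant_expansion_bound[OF fd bd A T FA]) (auto intro: that)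
  \<comment> \<open>With this radius the balls around \<open>F p\<close> and \<open>F q\<close> lie \<open>2 * C * r\<close> apart, and points of
    \<open>A\<^sup>-\<^sup>k S\<close> have values closer than that.\<close>
  define r where "r = dist (F p) (F q) / (2 * C + 2)"
  have r: "r > 0" using ne C(1) by (simp add: r_def)
  have rd: "dist (F p) (F q) = 2 * r + 2 * C * r" 
  proof -
    have "dist (F p) (F q) = r * (2 * C + 2)" using C(1) by (simp add: r_def)
    then show ?thesis by (simp add: algebra_simps)
  qed
  define S where "S = {x \<in> space m. F x \<in> ball (F p) r}"
  define S' where "S' = {x \<in> space m. F x \<in> ball (F q) r}"
  have sets: "S \<in> sets m" "S' \<in> sets m" unfolding S_def S'_def by (rule meas[OF open_ball])+
  have ps: "measure m S > 0" "measure m S' > 0"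
    unfolding S_def S'_def using pos[OF open_ball pq(1)] pos[OF open_ball pq(2)] r by auto
  \<comment> \<open>The correlation error of \<open>A\<^sup>-\<^sup>k S\<close> with a disjoint set \<open>R\<close> is \<open>measure m S * measure m R\<close>.\<close>
  define \<delta> where "\<delta> = min (measure m S * measure m S) (measure m S * measure m S')"
  have \<delta>: "\<delta> > 0" using ps by (simp add: \<delta>_def)
  let ?a = "\<lambda>k R. \<bar>measure m (((A ^^ k) -` S \<inter> space m) \<inter> R) - measure m S * measure m R\<bar>"
  have low: "\<delta> \<le> ?a k S + ?a k S'" for k
  proof -
    have "((A ^^ k) -` S \<inter> space m) \<inter> S = {} \<or> ((A ^^ k) -` S \<inter> space m) \<inter> S' = {}"
    proof (rule ccontr)
      assume "\<not> ?thesis"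
      then obtain x y where x: "x \<in> S" "(A ^^ k) x \<in> S" and y: "y \<in> S'" "(A ^^ k) y \<in> S" by blast
      have xy: "x \<in> space m" "y \<in> space m" using x y by (auto simp: S_def S'_def)
      have "dist (F ((A ^^ k) x)) (F ((A ^^ k) y)) < 2 * r"
        using x(2) y(2) dist_triangle3[of "F ((A ^^ k) x)" "F ((A ^^ k) y)" "F p"] by (simp add: S_def)
      then have "C * dist (F ((A ^^ k) x)) (F ((A ^^ k) y)) < C * (2 * r)"
        using C(1) by simp
      with C(2)[OF xy, of k] have "dist (F x) (F y) < 2 * C * r" by (simp add: dist_norm)
      moreover have "dist (F p) (F q) \<le> dist (F p) (F x) + dist (F x) (F y) + dist (F q) (F y)"
        using dist_triangle[of "F p" "F q" "F x"] dist_triangle[of "F x" "F q" "F y"]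
        by (simp add: dist_commute)
      moreover have "dist (F p) (F x) < r" "dist (F q) (F y) < r" using x y by (auto simp: S_def S'_def)
      ultimately show False using rd by linarith
    qed
    then show ?thesis
    proof
      assume "((A ^^ k) -` S \<inter> space m) \<inter> S = {}"
      then have "?a k S = measure m S * measure m S" by simp
      then show ?thesis by (simp add: \<delta>_def)
    next
      assume "((A ^^ k) -` S \<inter> space m) \<inter> S' = {}"
      then have "?a k S' = measure m S * measure m S'" by simp
      then show ?thesis by (simp add: \<delta>_def)
    qed
  qed
  have lim: "(\<lambda>n. (\<Sum>k<n. ?a k R) / real n) \<longlonglongrightarrow> 0" if "R \<in> sets m" for R
    using wm sets(1) that unfolding weakly_mixing_def by blast
  have "(\<lambda>n. (\<Sum>k<n. ?a k S) / real n + (\<Sum>k<n. ?a k S') / real n) \<longlonglongrightarrow> 0 + 0"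
    by (intro tendsto_add lim sets)
  then have "\<delta> \<le> 0 + 0"
  proof (rule LIMSEQ_le_const)
    have "\<delta> \<le> (\<Sum>k<n. ?a k S) / real n + (\<Sum>k<n. ?a k S') / real n" if "n \<ge> 1" for n
    proof -
      have "real n * \<delta> = (\<Sum>k<n. \<delta>)" by simp
      also have "\<dots> \<le> (\<Sum>k<n. ?a k S + ?a k S')" by (intro sum_mono low)
      finally have "real n * \<delta> \<le> (\<Sum>k<n. ?a k S) + (\<Sum>k<n. ?a k S')" by (simp add: sum.distrib)
      then show ?thesis using that by (simp add: field_simps add_divide_distrib[symmetric])
    qed
    then show "\<exists>N. \<forall>n\<ge>N. \<delta> \<le> (\<Sum>k<n. ?a k S) / real n + (\<Sum>k<n. ?a k S') / real n" by blast
  qed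
  then show False using \<delta> by simp
qed

section \<open>Haar measure\<close>

context lie_quotient
begin

lemma haar_openin_sets: "haar_measure G M \<Gamma> m \<Longrightarrow> openin (mtop quot) U \<Longrightarrow> U \<in> sets m"
  unfolding haar_measure_def by (auto intro: sigma_sets.Basic)

lemma haar_continuous_measurable:
  assumes m: "haar_measure G M \<Gamma> m" and f: "continuous_map (mtop quot) (mtop quot) f"
  shows "f \<in> measurable m m"
proof (rule measurable_sigma_sets)
  show "sets m = sigma_sets (space m) {V. openin (mtop quot) V}"
    and "{V. openin (mtop quot) V} \<subseteq> Pow (space m)"
    using m openin_subset topspace_quot unfolding haar_measure_def by auto
  have sp: "space m = topspace (mtop quot)" using m topspace_quot unfolding haar_measure_def by simp
  show "f \<in> space m \<rightarrow> space m" unfolding sp using f continuous_map_funspace by blast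
  fix V assume "V \<in> {V. openin (mtop quot) V}"
  then have "openin (mtop quot) {x \<in> topspace (mtop quot). f x \<in> V}"
    using f by (auto intro: openin_continuous_map_preimage)
  moreover have "f -` V \<inter> space m = {x \<in> topspace (mtop quot). f x \<in> V}" using sp by auto
  ultimately show "f -` V \<inter> space m \<in> sets m" using haar_openin_sets[OF m] by simp
qed

text \<open>
  Finitely many right translates of \<open>U\<close> cover the compact quotient, and all have the measure of \<open>U\<close>.
\<close>
lemma haar_full_support:
  assumes m: "haar_measure G M \<Gamma> m" and cpt: "compact_space (mtop quot)"
    and U: "openin (mtop quot) U" "x \<in> U"
  shows "measure m U > 0"
proof (rule ccontr)
  assume "\<not> measure m U > 0"
  then have "measure m U = 0" by (simp add: zero_less_measure_iff)
  interpret prob_space m using m unfolding haar_measure_def by blast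
  have sp: "space m = rcosets \<Gamma>" using m unfolding haar_measure_def by blast
  have null: "emeasure m U = 0" using \<open>measure m U = 0\<close> by (simp add: emeasure_eq_measure)
  let ?U = "\<lambda>h. {z \<in> topspace (mtop quot). z #> h \<in> U}"
  have op: "openin (mtop quot) (?U h)" if "h \<in> carrier G" for h
    using continuous_right_translation[OF that] U(1) by (rule openin_continuous_map_preimage)
  have nullU: "?U h \<in> null_sets m" if h: "h \<in> carrier G" for h
  proof -
    have "emeasure m U = emeasure (distr m m (\<lambda>x. x #> h)) U"
      using m h unfolding haar_measure_def by simp
    also have "\<dots> = emeasure m ((\<lambda>x. x #> h) -` U \<inter> space m)"
      by (rule emeasure_distr[OF haar_continuous_measurable[OF m continuous_right_translation[OF h]]
            haar_openin_sets[OF m U(1)]])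
    also have "(\<lambda>x. x #> h) -` U \<inter> space m = ?U h" using sp topspace_quot by auto
    finally show ?thesis using null haar_openin_sets[OF m op[OF h]] by (simp add: null_setsI)
  qed
  have x: "x \<in> rcosets \<Gamma>" using U openin_subset topspace_quot by blast
  then obtain g where g: "g \<in> carrier G" "x = proj g" by (rule rcosetsE)
  have "topspace (mtop quot) \<subseteq> \<Union>(?U ` carrier G)"
  proof
    fix z assume z: "z \<in> topspace (mtop quot)"
    then obtain k where k: "k \<in> carrier G" "z = proj k" using topspace_quot rcosetsE by metis
    have "z #> (inv k \<otimes> g) = x"
      using coset_mult_assoc[OF subgroup.subset[OF subgroup] k(1), of "inv k \<otimes> g"] k g
      by (simp add: m_assoc[symmetric])
    then show "z \<in> \<Union>(?U ` carrier G)" using z k g U(2) by (intro UN_I[of "inv k \<otimes> g"]) auto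
  qed
  then obtain \<F> where \<F>: "finite \<F>" "\<F> \<subseteq> ?U ` carrier G" "topspace (mtop quot) \<subseteq> \<Union>\<F>"
    using cpt op unfolding compact_space_alt by (metis (no_types, lifting) imageE)
  have "\<Union>\<F> \<in> null_sets m"
    using \<F>(1,2) nullU by (intro null_sets.finite_Union) auto
  moreover have "space m \<subseteq> \<Union>\<F>" using \<F>(3) sp topspace_quot by simp
  ultimately have "emeasure m (space m) = 0"
    by (metis null_setsD1 null_setsD2 emeasure_mono le_zero_eq)
  then show False using emeasure_space_1 by simp
qed

lemma countable_pseudobase:
  obtains \<B> where "countable \<B>" "\<And>U. U \<in> \<B> \<Longrightarrow> openin (mtop quot) U \<and> U \<noteq> {}"
    "\<And>V. openin (mtop quot) V \<Longrightarrow> V \<noteq> {} \<Longrightarrow> \<exists>U\<in>\<B>. U \<subseteq> V"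
proof -
  have "second_countable (mtop M)" using mfd unfolding manifold_def by blast
  then obtain \<C> where \<C>: "countable \<C>" "\<And>V. V \<in> \<C> \<Longrightarrow> openin (mtop M) V"
      "\<And>U x. openin (mtop M) U \<Longrightarrow> x \<in> U \<Longrightarrow> \<exists>V\<in>\<C>. x \<in> V \<and> V \<subseteq> U"
    unfolding second_countable_def by (metis (no_types, lifting))
  show ?thesis
  proof (rule that[of "(`) proj ` {V \<in> \<C>. V \<noteq> {}}"])
    show "countable ((`) proj ` {V \<in> \<C>. V \<noteq> {}})" using \<C>(1) by (intro countable_image) auto
    show "openin (mtop quot) U \<and> U \<noteq> {}" if "U \<in> (`) proj ` {V \<in> \<C>. V \<noteq> {}}" for U
      using that \<C>(2) open_proj by auto
    fix V assume V: "openin (mtop quot) V" "V \<noteq> {}"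
    then obtain x where x: "x \<in> V" by blast
    then obtain g where g: "g \<in> carrier G" "x = proj g" using V openin_quot rcosetsE by (metis subsetD)
    have "openin (mtop M) {g \<in> carrier G. proj g \<in> V}" using V openin_quot by blast
    then obtain W where W: "W \<in> \<C>" "g \<in> W" "W \<subseteq> {g \<in> carrier G. proj g \<in> V}" using \<C>(3) g x by blast
    then show "\<exists>U\<in>(`) proj ` {V \<in> \<C>. V \<noteq> {}}. U \<subseteq> V" by (intro bexI[of _ "proj ` W"]) auto
  qed
qed

text \<open>
  Evaluation at a point with a dense orbit is injective on \<open>E\<close>: the hypothesis \<open>zero\<close> propagates a
  zero along the orbit, and continuity extends it to the whole quotient.
\<close>
lemma ergodic_equivariant_fin_dim:
  assumes m: "haar_measure G M \<Gamma> m" and cpt: "compact_space (mtop quot)"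
    and erg: "ergodic m A" and A: "\<And>x. x \<in> rcosets \<Gamma> \<Longrightarrow> A x \<in> rcosets \<Gamma>"
    and E: "E \<subseteq> (C_infinity quot :: ('g set \<Rightarrow> 'v::real_normed_vector) set)" "subspace E"
    and fdv: "fin_dim (UNIV :: 'v set)"
    and zero: "\<And>F x. F \<in> E \<Longrightarrow> x \<in> rcosets \<Gamma> \<Longrightarrow> F x = 0 \<Longrightarrow> F (A x) = 0"
  shows "\<exists>B. finite B \<and> span B = E"
proof -
  obtain \<B> where \<B>: "countable \<B>" "\<And>U. U \<in> \<B> \<Longrightarrow> openin (mtop quot) U \<and> U \<noteq> {}"
    "\<And>V. openin (mtop quot) V \<Longrightarrow> V \<noteq> {} \<Longrightarrow> \<exists>U\<in>\<B>. U \<subseteq> V"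
    by (rule countable_pseudobase) (rule that)
  have prob: "prob_space m" and sp: "space m = rcosets \<Gamma>" using m unfolding haar_measure_def by auto
  have pos: "U \<in> sets m \<and> measure m U > 0" if "U \<in> \<B>" for U
    using \<B>(2)[OF that] haar_openin_sets[OF m] haar_full_support[OF m cpt] by blast
  obtain x0 where x0: "x0 \<in> rcosets \<Gamma>" "\<And>U. U \<in> \<B> \<Longrightarrow> \<exists>k. (A ^^ k) x0 \<in> U"
    using ergodic_dense_orbit[OF prob erg \<B>(1) pos] sp by metis
  have eval_inj: "F = 0" if F: "F \<in> E" "F x0 = 0" for F
  proof -
    have orb: "(A ^^ k) x0 \<in> rcosets \<Gamma> \<and> F ((A ^^ k) x0) = 0" for k
      by (induction k) (use x0 F A zero in auto)
    let ?V = "{x \<in> topspace (mtop quot). F x \<in> - {0}}"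
    have "continuous_map (mtop quot) euclidean F" using F E by (intro C_infinity_continuous) auto
    then have op: "openin (mtop quot) ?V" by (rule openin_continuous_map_preimage) auto
    have "?V = {}"
    proof (rule ccontr)
      assume "?V \<noteq> {}"
      then obtain U where "U \<in> \<B>" "U \<subseteq> ?V" using \<B>(3)[OF op] by blast
      then obtain k where "(A ^^ k) x0 \<in> ?V" using x0(2) by blast
      then show False using orb[of k] by simp
    qed
    moreover have "F x = 0" if "x \<notin> topspace (mtop quot)" for x
      using F E that unfolding C_infinity_def by blast
    ultimately show "F = 0" by (auto simp: fun_eq_iff zero_fun_def)
  qed
  obtain B where B: "B \<subseteq> E" "independent B" "E \<subseteq> span B"
    using maximal_independent_subset[of E] by blast
  have spB: "span B = E" using B E(2) by (metis span_minimal subset_antisym)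
  let ?ev = "\<lambda>F. F x0 :: 'v"
  have lin: "linear ?ev" by (rule linearI) (simp_all add: plus_fun_def scaleR_fun_def)
  have inj: "inj_on ?ev (span B)"
    using linear_injective_on_subspace_0[OF lin subspace_span, of B] eval_inj spB by auto
  have "independent (?ev ` B)" by (rule linear_independent_injective_image[OF lin B(2) inj])
  then have "finite (?ev ` B)" using fin_dim_independent_finite[OF fdv] by blast
  then have "finite B" using inj_on_subset[OF inj span_superset] by (rule finite_imageD)
  with spB show ?thesis by blast
qed

end

section \<open>Invariant complex structures\<close>

theorem corollary2:
  fixes G :: "('g, 'r) monoid_scheme"
    and M :: "('g, 'e::real_normed_vector) mfd"
    and \<Gamma> :: "'g set"
    and m :: "'g set measure"
    and A :: "'g set \<Rightarrow> 'g set"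
  assumes "lie_group G M"
    and "simply_connected_space (mtop M)"
    and "cocompact_lattice G M \<Gamma>"
    and "haar_measure G M \<Gamma> m"
    and "affine_automorphism G M \<Gamma> A"
  shows "(ergodic m A \<longrightarrow>
           (\<exists>E :: ('g set \<Rightarrow> ('e \<Rightarrow>\<^sub>L 'e)) set.
              E \<subseteq> C_infinity (quotient_mfd G M \<Gamma>) \<and> subspace E \<and> (\<exists>B. finite B \<and> span B = E) \<and>
              (\<forall>J \<in> invariant_complex_structures (quotient_mfd G M \<Gamma>) A.
                 \<exists>F\<in>E. represents G M \<Gamma> F J)))
       \<and> (weakly_mixing m A \<longrightarrow>
           (\<forall>J \<in> invariant_complex_structures (quotient_mfd G M \<Gamma>) A. left_invariant G M \<Gamma> J))"
proof -
  have cpt: "compact_space (mtop (quotient_mfd G M \<Gamma>))" and sub: "subgroup \<Gamma> G"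
    and disc: "subtopology (mtop M) \<Gamma> = discrete_topology \<Gamma>"
    using assms(3) unfolding cocompact_lattice_def lattice_subgroup_def by auto
  obtain g0 \<Phi> where g0: "g0 \<in> carrier G" and \<Phi>: "lie_group_automorphism G M \<Phi>"
    and A_eq: "\<And>g. g \<in> carrier G \<Longrightarrow> A (\<Gamma> #>\<^bsub>G\<^esub> g) = \<Gamma> #>\<^bsub>G\<^esub> (g0 \<otimes>\<^bsub>G\<^esub> \<Phi> g)"
    using assms(5) unfolding affine_automorphism_def by metis
  interpret lie_quotient G M \<Gamma> by (rule lie_quotient.intro[OF assms(1) sub disc])
  interpret compose: bounded_bilinear "(o\<^sub>L) :: ('e \<Rightarrow>\<^sub>L 'e) \<Rightarrow> ('e \<Rightarrow>\<^sub>L 'e) \<Rightarrow> _"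
    by (rule bounded_bilinear_blinfun_compose)
  note m = assms(4)
  have prob: "prob_space m" and sp: "space m = rcosets\<^bsub>G\<^esub> \<Gamma>" using m unfolding haar_measure_def by auto
  have smA: "smooth_map quot quot A" and bijA: "bij_betw A (rcosets\<^bsub>G\<^esub> \<Gamma>) (rcosets\<^bsub>G\<^esub> \<Gamma>)"
    using assms(5) unfolding affine_automorphism_def diffeo_def topspace_quot by auto
  have Ar: "A x \<in> rcosets\<^bsub>G\<^esub> \<Gamma>" if "x \<in> rcosets\<^bsub>G\<^esub> \<Gamma>" for x using bijA that by (rule bij_betw_apply)
  define L where "L = tangent_map M M \<Phi> \<one>\<^bsub>G\<^esub>"
  obtain L' where L': "L o\<^sub>L L' = id_blinfun" "L' o\<^sub>L L = id_blinfun"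
    using smooth_automorphism_deriv(3)[OF \<Phi>] unfolding L_def by blast
  have fdW: "fin_dim (UNIV :: ('e \<Rightarrow>\<^sub>L 'e) set)" by (rule fin_dim_blinfun[OF fd fd])
  define E where "E = {F \<in> C_infinity quot. \<forall>x\<in>rcosets\<^bsub>G\<^esub> \<Gamma>. F (A x) o\<^sub>L L = L o\<^sub>L F x}"
  have rep: "\<exists>F\<in>E. represents G M \<Gamma> F J" if J: "J \<in> invariant_complex_structures quot A" for J
  proof -
    have Js: "smooth_endo quot J"
      and Ji: "\<And>x. x \<in> rcosets\<^bsub>G\<^esub> \<Gamma> \<Longrightarrow> tangent_map quot quot A x o\<^sub>L J x = J (A x) o\<^sub>L tangent_map quot quot A x"
      using J unfolding invariant_complex_structures_def complex_structure_def topspace_quot by auto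
    obtain F where F: "represents G M \<Gamma> F J" "\<And>x. x \<notin> rcosets\<^bsub>G\<^esub> \<Gamma> \<Longrightarrow> F x = 0"
      by (rule representative_exists) (rule that)
    have "F \<in> C_infinity quot" by (rule representative_smooth[OF Js F])
    moreover have "F (A x) o\<^sub>L L = L o\<^sub>L F x" if "x \<in> rcosets\<^bsub>G\<^esub> \<Gamma>" for x
      unfolding L_def by (rule representative_equivariant[OF smA \<Phi> g0 A_eq Ji F(1) that])
    ultimately show ?thesis using F(1) unfolding E_def by blast
  qed
  have E1: "E \<subseteq> C_infinity quot" unfolding E_def by blast
  have E2: "subspace E"
    using C_infinity_subspace unfolding subspace_def E_def
    by (auto simp: plus_fun_def zero_fun_def scaleR_fun_def compose.add_left compose.add_right
        compose.scaleR_left compose.scaleR_right)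
  have FA: "F (A x) = L o\<^sub>L F x o\<^sub>L L'" if "F \<in> E" "x \<in> rcosets\<^bsub>G\<^esub> \<Gamma>" for F x
  proof -
    have "F (A x) = (F (A x) o\<^sub>L L) o\<^sub>L L'" using L' by (simp add: blinfun_compose_assoc)
    then show ?thesis using that unfolding E_def by simp
  qed
  have fin: "\<exists>B. finite B \<and> span B = E" if "ergodic m A"
    by (rule ergodic_equivariant_fin_dim[OF m cpt that Ar E1 E2 fdW]) (simp_all add: FA)
  have inv: "left_invariant G M \<Gamma> J"
    if wm: "weakly_mixing m A" and J: "J \<in> invariant_complex_structures quot A" for J
  proof -
    obtain F where F: "F \<in> E" "represents G M \<Gamma> F J" using rep[OF J] by blast
    have cont: "continuous_map (mtop quot) euclidean F" using F(1) E1 by (intro C_infinity_continuous) auto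
    have op: "openin (mtop quot) {x \<in> space m. F x \<in> P}" if "open P" for P
      using openin_continuous_map_preimage[OF cont, of P] that sp topspace_quot by simp
    \<comment> \<open>For a solution of \<open>F(Ax) L = L F(x)\<close> the equivariance is under conjugation by \<open>L\<close>.\<close>
    let ?T = "\<lambda>w. L o\<^sub>L w o\<^sub>L L'"
    have lin: "linear ?T"
      by (rule linearI) (simp_all add: compose.add_left compose.add_right
        compose.scaleR_left compose.scaleR_right)
    have inj: "inj ?T"
    proof (rule inj_on_inverseI[where g = "\<lambda>w. L' o\<^sub>L w o\<^sub>L L"])
      fix w
      have "L' o\<^sub>L (L o\<^sub>L w o\<^sub>L L') o\<^sub>L L = (L' o\<^sub>L L) o\<^sub>L w o\<^sub>L (L' o\<^sub>L L)" by (simp only: blinfun_compose_assoc)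
      then show "L' o\<^sub>L (L o\<^sub>L w o\<^sub>L L') o\<^sub>L L = w" using L' by simp
    qed
    have bd: "bounded (F ` space m)"
    proof -
      have "compactin euclidean (F ` topspace (mtop quot))"
        using cpt cont by (intro image_compactin) (auto simp: compact_space_def)
      then show ?thesis using sp topspace_quot compact_imp_bounded by (simp add: compactin_euclidean_iff)
    qed
    have surj: "A ` space m = space m" using bijA sp by (simp add: bij_betw_imp_surj_on)
    have "F p = F q" if "p \<in> space m" "q \<in> space m" for p q
    proof (rule weakly_mixing_equivariant_constant[OF prob wm surj _ _ fdW bd lin inj _ that])
      show "{x \<in> space m. F x \<in> P} \<in> sets m" if "open P" for P
        by (rule haar_openin_sets[OF m op[OF that]])
      show "measure m {x \<in> space m. F x \<in> P} > 0" if "open P" "x \<in> space m" "F x \<in> P" for P x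
        by (rule haar_full_support[OF m cpt op[OF that(1)], of x]) (use that in simp)
      show "F (A x) = L o\<^sub>L F x o\<^sub>L L'" if "x \<in> space m" for x
        using FA[OF F(1)] that sp by simp
    qed
    then have const: "F (proj g) = F (proj \<one>\<^bsub>G\<^esub>)" if "g \<in> carrier G" for g
      using that proj_in_rcosets one_closed unfolding sp by blast
    have "represents G M \<Gamma> (\<lambda>_. F (proj \<one>\<^bsub>G\<^esub>)) J"
      unfolding represents_def
    proof
      fix g assume g: "g \<in> carrier G"
      then have "J (proj g) o\<^sub>L field g = field g o\<^sub>L F (proj g)" using F(2) unfolding represents_def by blast
      then show "J (proj g) o\<^sub>L field g = field g o\<^sub>L F (proj \<one>\<^bsub>G\<^esub>)" unfolding const[OF g] .
    qed
    then show ?thesis unfolding left_invariant_def by blast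
  qed
  show ?thesis
  proof (intro conjI impI ballI)
    show "\<exists>E. E \<subseteq> C_infinity quot \<and> subspace E \<and> (\<exists>B. finite B \<and> span B = E) \<and>
        (\<forall>J\<in>invariant_complex_structures quot A. \<exists>F\<in>E. represents G M \<Gamma> F J)" if "ergodic m A"
      by (rule exI[of _ E]) (intro conjI E1 E2 fin[OF that] ballI rep)
  qed (rule inv)
qed

end
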